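(* Consider the $K$-armed stochastic bandit problem with $[0,1]$-supported reward distributions, unique optimal arm $1$ and gaps $\Delta_i=\mu_1-\mu_i$. For every $\alpha\in[0,1]$ and horizon $T\ge2$, the algorithm TS-MA-$\alpha$ run with inputs $T$ and $\alpha$ has problem-dependent regret $$\mathcal{R}(T)\le\sum_{i:\Delta_i>0}O\left(\frac{\ln^{\alpha+1}(T)}{\Delta_i}\right),$$ and worst-case regret $\mathcal{R}(T)\le O\left(\sqrt{KT\ln^{\alpha+1}(T)}\right)$.
   Context: Bandit problem: there is a set of arms $\mathcal{A}=\{1,\dots,K\}$, $K\ge2$; arm $i$ has an unknown reward distribution $p_i$ supported in $[0,1]$ with mean $\mu_i$. In each round $t$, a reward vector $(X_1(t),\dots,X_K(t))$ with $X_i(t)\sim p_i$ is generated, independently across rounds; the learner pulls an arm $i_t$ based on past observations (and its own randomization) and observes only $X_{i_t}(t)$. Arm $1$ is the unique optimal arm: $\mu_1>\mu_i$ for all $i\ne1$; $\Delta_i:=\mu_1-\mu_i$. The pseudo-regret is $\mathcal{R}(T)=T\mu_1-\mathbb{E}\left[\sum_{t=1}^TX_{i_t}(t)\right]=\sum_i\sum_{t=1}^T\mathbb{E}[\mathbf{1}\{i_t=i\}]\Delta_i$. Notation: $\ln^{\beta}(T)=(\ln T)^\beta$; $O(\cdot)$ hides a universal constant; $n_i$ and $\hat\mu_{i,n_i}$ denote the current number of pulls of arm $i$ and the empirical mean of the rewards observed from it; $\mathcal{N}(\mu,\sigma^2)$ is the Gaussian distribution with mean $\mu$ and variance $\sigma^2$;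 $c_0:=1/(2\sqrt{2e\pi})$; $[\phi]=\{1,\dots,\phi\}$. Algorithm TS-MA-$\alpha$ (inputs: horizon $T$, $\alpha\in[0,1]$): set $\phi=\left\lceil 2T^{0.5(1-\alpha)}\ln^{0.5(3-\alpha)}(T)/c_0\right\rceil$. Pull each arm $i$ once (rounds $1,\dots,K$) to initialize $n_i$ and $\hat\mu_{i,n_i}$, and set $\theta_i\leftarrow\max_{h\in[\phi]}\theta^h_{i,n_i}$, where the $\theta^h_{i,n_i}\sim\mathcal{N}\left(\hat\mu_{i,n_i},\ln^\alpha(T)/n_i\right)$ are i.i.d. over $h\in[\phi]$. For $t=K+1,\dots,T$: pull $i_t\in\arg\max_{i\in\mathcal{A}}\theta_i$, observe $X_{i_t}(t)$, update $n_{i_t}$ and $\hat\mu_{i_t,n_{i_t}}$, and (for arm $i_t$ only) redraw $\theta_{i_t}\leftarrow\max_{h\in[\phi]}\theta^h_{i_t,n_{i_t}}$ with fresh i.i.d. $\theta^h_{i_t,n_{i_t}}\sim\mathcal{N}\left(\hat\mu_{i_t,n_{i_t}},\ln^\alpha(T)/n_{i_t}\right)$; the other $\theta_i$ are kept unchanged. *)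

theory Defs
  imports "HOL-Probability.Probability"
begin

section \<open>Stochastic bandits\<close>

definition arm_mean :: "(nat \<Rightarrow> real measure) \<Rightarrow> nat \<Rightarrow> real" where
  "arm_mean p i = (\<integral>x. x \<partial>p i)"

definition gap :: "(nat \<Rightarrow> real measure) \<Rightarrow> nat \<Rightarrow> real" where
  "gap p i = arm_mean p 1 - arm_mean p i"

text \<open>
  \<open>\<nu> t\<close> is the joint law of the reward vector of round \<open>t\<close>. Only its marginals are prescribed:
  rewards of different arms in the same round may be dependent. Independence across
  rounds is built into the definition of \<open>ts_ma_run\<close> below.
\<close>

locale stochastic_bandit =
  fixes K :: nat and p :: "nat \<Rightarrow> real measure" and \<nu> :: "nat \<Rightarrow> (nat \<Rightarrow> real) measure"
  assumes two_arms: "K \<ge> 2"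
    and prob_arm: "\<And>i. i \<in> {1..K} \<Longrightarrow> prob_space (p i)"
    and sets_arm: "\<And>i. i \<in> {1..K} \<Longrightarrow> sets (p i) = sets borel"
    and supported: "\<And>i. i \<in> {1..K} \<Longrightarrow> measure (p i) {0..1} = 1"
    and unique_optimal: "\<And>i. i \<in> {1..K} \<Longrightarrow> i \<noteq> 1 \<Longrightarrow> arm_mean p i < arm_mean p 1"
    and prob_rewards: "\<And>t. prob_space (\<nu> t)"
    and sets_rewards: "\<And>t. sets (\<nu> t) = sets (PiM {1..K} (\<lambda>_. borel))"
    and marginal: "\<And>t i. i \<in> {1..K} \<Longrightarrow> distr (\<nu> t) borel (\<lambda>x. x i) = p i"

section \<open>The algorithm\<close>

definition gaussian :: "real \<Rightarrow> real \<Rightarrow> real measure" where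
  "gaussian m v = density lborel (\<lambda>x. ennreal (normal_density m (sqrt v) x))"

definition c0 :: real where
  "c0 = 1 / (2 * sqrt (2 * exp 1 * pi))"

definition num_samples :: "nat \<Rightarrow> real \<Rightarrow> nat" where
  "num_samples T \<alpha> =
     nat \<lceil>2 * real T powr (0.5 * (1 - \<alpha>)) * ln (real T) powr (0.5 * (3 - \<alpha>)) / c0\<rceil>"

text \<open>
  A state \<open>(n, S, \<theta>)\<close> holds, for each arm in \<open>{1..K}\<close>, the number of pulls, the sum of the rewards observed
  from it (so its empirical mean is \<open>S i / n i\<close>) and the current index;
  the values at other indices are never used.
\<close>

type_synonym state = "(nat \<Rightarrow> nat) \<times> (nat \<Rightarrow> real) \<times> (nat \<Rightarrow> real)"

definition state_space :: "state measure" where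
  "state_space =
     PiM UNIV (\<lambda>_. count_space UNIV) \<Otimes>\<^sub>M (PiM UNIV (\<lambda>_. borel) \<Otimes>\<^sub>M PiM UNIV (\<lambda>_. borel))"

definition argmax_arms :: "nat \<Rightarrow> (nat \<Rightarrow> real) \<Rightarrow> nat set" where
  "argmax_arms K \<theta> = {i. is_arg_max \<theta> (\<lambda>j. j \<in> {1..K}) i}"

text \<open>
  Ties are broken by an arbitrary, possibly randomized rule: \<open>tie t A\<close> is the law of the arm
  pulled in round \<open>t\<close> when \<open>A\<close> is the set of maximizers.
\<close>

definition tie_breaking :: "nat \<Rightarrow> (nat \<Rightarrow> nat set \<Rightarrow> nat pmf) \<Rightarrow> bool" where
  "tie_breaking K tie \<longleftrightarrow> (\<forall>t A. A \<subseteq> {1..K} \<and> A \<noteq> {} \<longrightarrow> set_pmf (tie t A) \<subseteq> A)"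

definition choose_arm ::
    "nat \<Rightarrow> (nat \<Rightarrow> nat set \<Rightarrow> nat pmf) \<Rightarrow> nat \<Rightarrow> (nat \<Rightarrow> real) \<Rightarrow> nat pmf" where
  "choose_arm K tie t \<theta> = (if t \<le> K then return_pmf t else tie t (argmax_arms K \<theta>))"

text \<open>Both the reward and the Gaussian samples are drawn afresh in every round.\<close>

definition ts_ma_step ::
    "nat \<Rightarrow> (nat \<Rightarrow> (nat \<Rightarrow> real) measure) \<Rightarrow> (nat \<Rightarrow> nat set \<Rightarrow> nat pmf) \<Rightarrow> nat \<Rightarrow> real \<Rightarrow>
     nat \<Rightarrow> state \<Rightarrow> state measure" where
  "ts_ma_step K \<nu> tie T \<alpha> t = (\<lambda>(n, S, \<theta>).
     do {
       i \<leftarrow> measure_pmf (choose_arm K tie t \<theta>);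
       X \<leftarrow> \<nu> t;
       let n' = n(i := n i + 1);
       let S' = S(i := S i + X i);
       z \<leftarrow> PiM {1..num_samples T \<alpha>}
              (\<lambda>h. gaussian (S' i / real (n' i)) (ln (real T) powr \<alpha> / real (n' i)));
       return state_space (n', S', \<theta>(i := Max (z ` {1..num_samples T \<alpha>})))
     })"

text \<open>
  \<open>ts_ma_run K \<nu> tie T \<alpha> t\<close> is the law of the state after \<open>t\<close> rounds. The initial indices are
  irrelevant, as they are overwritten before they are first compared.
\<close>

primrec ts_ma_run ::
    "nat \<Rightarrow> (nat \<Rightarrow> (nat \<Rightarrow> real) measure) \<Rightarrow> (nat \<Rightarrow> nat set \<Rightarrow> nat pmf) \<Rightarrow> nat \<Rightarrow> real \<Rightarrow>
     nat \<Rightarrow> state measure" where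
  "ts_ma_run K \<nu> tie T \<alpha> 0 =
     return state_space (\<lambda>_. 0, \<lambda>_. 0, \<lambda>_. 0)"
| "ts_ma_run K \<nu> tie T \<alpha> (Suc t) =
     ts_ma_run K \<nu> tie T \<alpha> t \<bind> ts_ma_step K \<nu> tie T \<alpha> (Suc t)"

text \<open>
  The sum over the arms of the accumulated rewards \<open>S i\<close> after \<open>T\<close> rounds is the total reward
  collected in rounds \<open>1, \<dots>, T\<close>.
\<close>

definition ts_ma_regret ::
    "nat \<Rightarrow> (nat \<Rightarrow> real measure) \<Rightarrow> (nat \<Rightarrow> (nat \<Rightarrow> real) measure) \<Rightarrow>
     (nat \<Rightarrow> nat set \<Rightarrow> nat pmf) \<Rightarrow> nat \<Rightarrow> real \<Rightarrow> real" where
  "ts_ma_regret K p \<nu> tie T \<alpha> =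
     real T * arm_mean p 1 - (\<integral>(n, S, \<theta>). (\<Sum>i\<in>{1..K}. S i) \<partial>ts_ma_run K \<nu> tie T \<alpha> T)"

section \<open>Well-definedness\<close>

text \<open>
  The monadic bind on measures is only meaningful for measurable kernels. The steps of the
  algorithm are measurable Markov kernels, so the law of every state is a probability measure.
\<close>

abbreviation (input) reward_vectors :: "nat \<Rightarrow> (nat \<Rightarrow> real) measure" where
  "reward_vectors K \<equiv> PiM {1..K} (\<lambda>_. borel)"

lemma gaussian_affine:
  assumes "v > 0"
  shows "gaussian m v = distr (gaussian 0 1) borel (\<lambda>x. m + sqrt v * x)"
proof -
  interpret g: prob_space "gaussian 0 1"
    unfolding gaussian_def using prob_space_normal_density[of 1 0] by simp
  have 1: "distributed (gaussian 0 1) lborel (\<lambda>x. x) (normal_density 0 1)"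
    unfolding distributed_def gaussian_def
    by (auto simp: distr_id2)
  have "distributed (gaussian 0 1) lborel (\<lambda>x. m + sqrt v * x) (normal_density (m + sqrt v * 0) (\<bar>sqrt v\<bar> * 1))"
    by (rule g.normal_density_affine[OF 1]) (use assms in auto)
  hence "distr (gaussian 0 1) lborel (\<lambda>x. m + sqrt v * x) = gaussian m v"
    using assms by (simp add: distributed_def gaussian_def)
  thus ?thesis by (metis distr_cong sets_lborel)
qed

lemma prob_gaussian: "v > 0 \<Longrightarrow> prob_space (gaussian m v)"
  unfolding gaussian_def by (rule prob_space_normal_density) simp

lemma sets_gaussian[measurable_cong, simp]: "sets (gaussian m v) = sets borel"
  by (simp add: gaussian_def)

lemma PiM_gaussian_affine:
  assumes "v > 0" "finite I"
  shows "PiM I (\<lambda>_. gaussian m v) =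
    distr (PiM I (\<lambda>_. gaussian 0 1)) (PiM I (\<lambda>_. borel)) (\<lambda>z. \<lambda>i\<in>I. m + sqrt v * z i)"
proof -
  let ?P = "PiM I (\<lambda>_. gaussian 0 1)"
  have "distr ?P ?P (compose I (\<lambda>x. m + sqrt v * x))
      = PiM I (\<lambda>_. distr (gaussian 0 1) (gaussian 0 1) (\<lambda>x. m + sqrt v * x))"
    by (rule distr_PiM_finite_prob_space'[OF assms(2)]) (auto simp: prob_gaussian)
  also have "distr (gaussian 0 1) (gaussian 0 1) (\<lambda>x. m + sqrt v * x) = gaussian m v"
    using gaussian_affine[OF assms(1)] by (metis distr_cong sets_gaussian)
  also have "distr ?P ?P (compose I (\<lambda>x. m + sqrt v * x)) = distr ?P (PiM I (\<lambda>_. borel)) (compose I (\<lambda>x. m + sqrt v * x))"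
    by (intro distr_cong sets_PiM_cong) auto
  finally show ?thesis by (simp add: compose_def[abs_def])
qed

lemma measurable_PiM_gaussian:
  assumes [measurable]: "f \<in> borel_measurable M" "g \<in> borel_measurable M"
    and pos: "\<And>x. x \<in> space M \<Longrightarrow> g x > 0" and fin: "finite I"
  shows "(\<lambda>x. PiM I (\<lambda>_. gaussian (f x) (g x))) \<in> M \<rightarrow>\<^sub>M prob_algebra (PiM I (\<lambda>_. borel))"
proof -
  let ?P = "PiM I (\<lambda>_. gaussian 0 1)"
  have s: "sets ?P = sets (PiM I (\<lambda>_. borel))" by (intro sets_PiM_cong) auto
  have P: "?P \<in> space (prob_algebra (PiM I (\<lambda>_. borel)))"
    unfolding space_prob_algebra using s by (auto intro!: prob_space_PiM prob_gaussian)
  have "(\<lambda>x. distr ?P (PiM I (\<lambda>_. borel)) (\<lambda>z. \<lambda>i\<in>I. f x + sqrt (g x) * z i)) \<in> M \<rightarrow>\<^sub>M prob_algebra (PiM I (\<lambda>_. borel))"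
    by (rule measurable_distr_prob_space2[OF measurable_const[OF P]]) measurable
  thus ?thesis
    by (subst measurable_cong[OF PiM_gaussian_affine]) (use pos fin in auto)
qed

lemma measurable_argmax_arms:
  "argmax_arms K \<in> PiM UNIV (\<lambda>_. borel) \<rightarrow>\<^sub>M count_space UNIV"
proof -
  have *: "argmax_arms K \<theta> \<in> Pow {1..K}" for \<theta>
    by (auto simp: argmax_arms_def is_arg_max_def)
  have "argmax_arms K \<in> PiM UNIV (\<lambda>_. borel) \<rightarrow>\<^sub>M count_space (Pow {1..K})"
  proof (subst measurable_count_space_eq2, simp, intro conjI ballI)
    fix A :: "nat set"
    have "argmax_arms K -` {A} \<inter> space (PiM UNIV (\<lambda>_. borel)) =
      {\<theta> \<in> space (PiM UNIV (\<lambda>_. borel::real measure)). \<forall>i. (i \<in> {1..K} \<and> (\<forall>j\<in>{1..K}. \<not> \<theta> i < \<theta> j)) = (i \<in> A)}"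
      by (simp add: argmax_arms_def is_arg_max_def set_eq_iff Ball_def) blast
    also have "\<dots> \<in> sets (PiM UNIV (\<lambda>_. borel))" by measurable
    finally show "argmax_arms K -` {A} \<inter> space (PiM UNIV (\<lambda>_. borel)) \<in> sets (PiM UNIV (\<lambda>_. borel))" .
  qed (use * in auto)
  from measurable_compose[OF this, of "\<lambda>x. x" "count_space UNIV"] show ?thesis by simp
qed

lemma measurable_choose_arm:
  "(\<lambda>\<theta>. measure_pmf (choose_arm K tie t \<theta>)) \<in> PiM UNIV (\<lambda>_. borel) \<rightarrow>\<^sub>M prob_algebra (count_space UNIV)"
proof -
  have q: "(\<lambda>A. measure_pmf (q A)) \<in> count_space UNIV \<rightarrow>\<^sub>M prob_algebra (count_space UNIV)" for q :: "nat set \<Rightarrow> nat pmf"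
    by (auto simp: space_prob_algebra measure_pmf.prob_space_axioms)
  show ?thesis
    using measurable_compose[OF measurable_argmax_arms q[of "\<lambda>A. if t \<le> K then return_pmf t else tie t A"]]
    by (simp add: choose_arm_def)
qed

context stochastic_bandit begin

lemma rewards_in_prob_algebra: "\<nu> t \<in> space (prob_algebra (reward_vectors K))"
  by (simp add: space_prob_algebra sets_rewards prob_rewards)

lemma measurable_reward: "(\<lambda>X. X i) \<in> reward_vectors K \<rightarrow>\<^sub>M borel"
proof (cases "i \<in> {1..K}")
  case False
  have "(\<lambda>X. undefined) \<in> reward_vectors K \<rightarrow>\<^sub>M (borel :: real measure)" by simp
  thus ?thesis by (rule measurable_cong[THEN iffD1, rotated]) (use False in \<open>auto simp: space_PiM PiE_def extensional_def\<close>)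
qed simp

lemma measurable_ts_ma_step:
  assumes T: "T \<ge> 2"
  shows "ts_ma_step K \<nu> tie T \<alpha> t \<in> state_space \<rightarrow>\<^sub>M prob_algebra state_space"
proof -
  let ?I = "{1..num_samples T \<alpha>}"
  let ?L = "ln (real T) powr \<alpha>"
  have L: "?L > 0" using T by simp
  define body where "body i n S \<theta> X = PiM ?I (\<lambda>h. gaussian ((S i + X i) / real (n i + 1)) (?L / real (n i + 1))) \<bind>
     (\<lambda>z. return state_space (n(i := n i + 1), S(i := S i + X i), \<theta>(i := Max (z ` ?I))))" for i n S \<theta> and X :: "nat \<Rightarrow> real"
  have step: "ts_ma_step K \<nu> tie T \<alpha> t = (\<lambda>(n,S,\<theta>). measure_pmf (choose_arm K tie t \<theta>) \<bind> (\<lambda>i. \<nu> t \<bind> (\<lambda>X. body i n S \<theta> X)))"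
    by (simp add: ts_ma_step_def body_def Let_def fun_eq_iff)
  have b: "(\<lambda>((n, S, \<theta>), X). body i n S \<theta> X) \<in> state_space \<Otimes>\<^sub>M reward_vectors K \<rightarrow>\<^sub>M prob_algebra state_space" for i
  proof -
    have Xi: "(\<lambda>w. snd w i) \<in> state_space \<Otimes>\<^sub>M reward_vectors K \<rightarrow>\<^sub>M borel"
      by (rule measurable_compose[OF measurable_snd measurable_reward])
    have Xi2: "(\<lambda>w. snd (fst w) i) \<in> (state_space \<Otimes>\<^sub>M reward_vectors K) \<Otimes>\<^sub>M N \<rightarrow>\<^sub>M borel" for N :: "(nat \<Rightarrow> real) measure"
      by (rule measurable_compose[OF measurable_compose[OF measurable_fst measurable_snd] measurable_reward])
    have ni: "(\<lambda>s. fst s j) \<in> state_space \<rightarrow>\<^sub>M count_space UNIV" for j unfolding state_space_def by measurable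
    have Si: "(\<lambda>s. fst (snd s) j) \<in> state_space \<rightarrow>\<^sub>M borel" for j unfolding state_space_def by measurable
    have Ti: "(\<lambda>s. snd (snd s) j) \<in> state_space \<rightarrow>\<^sub>M borel" for j unfolding state_space_def by measurable
    have fst2: "(\<lambda>w. fst (fst w)) \<in> (state_space \<Otimes>\<^sub>M reward_vectors K) \<Otimes>\<^sub>M N \<rightarrow>\<^sub>M state_space" for N :: "(nat \<Rightarrow> real) measure"
      by measurable
    note ni1 = measurable_compose[OF measurable_fst ni] and Si1 = measurable_compose[OF measurable_fst Si]
    note ni2 = measurable_compose[OF fst2 ni] and Si2 = measurable_compose[OF fst2 Si] and Ti2 = measurable_compose[OF fst2 Ti]
    have 1: "(\<lambda>w. PiM ?I (\<lambda>_. gaussian ((fst (snd (fst w)) i + snd w i) / real (fst (fst w) i + 1)) (?L / real (fst (fst w) i + 1))))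
      \<in> state_space \<Otimes>\<^sub>M reward_vectors K \<rightarrow>\<^sub>M prob_algebra (PiM ?I (\<lambda>_. borel))"
    proof (rule measurable_PiM_gaussian)
      have [measurable]: "(\<lambda>w. real (fst (fst w) i + 1)) \<in> borel_measurable (state_space \<Otimes>\<^sub>M reward_vectors K)"
        by (rule measurable_compose[OF ni1]) simp
      show "(\<lambda>w. (fst (snd (fst w)) i + snd w i) / real (fst (fst w) i + 1)) \<in> borel_measurable (state_space \<Otimes>\<^sub>M reward_vectors K)"
        by (intro borel_measurable_divide borel_measurable_add Si1 Xi) fact
      show "(\<lambda>w. ?L / real (fst (fst w) i + 1)) \<in> borel_measurable (state_space \<Otimes>\<^sub>M reward_vectors K)"
        by (intro borel_measurable_divide measurable_const) (simp, fact)
    qed (use L in auto)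
    have 2: "(\<lambda>w. (let (((n,S,\<theta>),X),z) = w in (n(i := n i + 1), S(i := S i + X i), \<theta>(i := Max (z ` ?I)))))
       \<in> (state_space \<Otimes>\<^sub>M reward_vectors K) \<Otimes>\<^sub>M PiM ?I (\<lambda>_. borel) \<rightarrow>\<^sub>M state_space"
    proof -
      have M: "(\<lambda>z. Max (z ` ?I)) \<in> PiM ?I (\<lambda>_. borel :: real measure) \<rightarrow>\<^sub>M borel"
      proof -
        have "(\<lambda>z. Max ((\<lambda>h. z h) ` ?I)) \<in> PiM ?I (\<lambda>_. borel :: real measure) \<rightarrow>\<^sub>M borel"
          by (rule borel_measurable_Max) auto
        thus ?thesis by simp
      qed
      let ?W = "(state_space \<Otimes>\<^sub>M reward_vectors K) \<Otimes>\<^sub>M PiM ?I (\<lambda>_. borel :: real measure)"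
      have n: "(\<lambda>w. (fst (fst (fst w)))(i := fst (fst (fst w)) i + 1)) \<in> ?W \<rightarrow>\<^sub>M PiM UNIV (\<lambda>_. count_space UNIV)"
      proof (rule measurable_PiM_single')
        fix j
        show "(\<lambda>w. ((fst (fst (fst w)))(i := fst (fst (fst w)) i + 1)) j) \<in> ?W \<rightarrow>\<^sub>M count_space UNIV"
        proof (cases "j = i")
          case True
          show ?thesis unfolding True fun_upd_same by (rule measurable_compose[OF ni2]) simp
        next
          case False
          show ?thesis using False by (simp add: ni2 del: atLeastAtMost_iff One_nat_def)
        qed
      qed simp
      have S: "(\<lambda>w. (fst (snd (fst (fst w))))(i := fst (snd (fst (fst w))) i + snd (fst w) i)) \<in> ?W \<rightarrow>\<^sub>M PiM UNIV (\<lambda>_. borel)"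
      proof (rule measurable_PiM_single')
        fix j
        show "(\<lambda>w. ((fst (snd (fst (fst w))))(i := fst (snd (fst (fst w))) i + snd (fst w) i)) j) \<in> ?W \<rightarrow>\<^sub>M borel"
          by (cases "j = i") (simp_all add: Si2 borel_measurable_add[OF Si2 Xi2] del: One_nat_def)
      qed simp
      have T: "(\<lambda>w. (snd (snd (fst (fst w))))(i := Max (snd w ` ?I))) \<in> ?W \<rightarrow>\<^sub>M PiM UNIV (\<lambda>_. borel)"
      proof (rule measurable_PiM_single')
        fix j
        show "(\<lambda>w. ((snd (snd (fst (fst w))))(i := Max (snd w ` ?I))) j) \<in> ?W \<rightarrow>\<^sub>M borel"
          by (cases "j = i") (simp_all add: Ti2 measurable_compose[OF measurable_snd M] del: One_nat_def)
      qed simp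
      show ?thesis unfolding Let_def case_prod_unfold
        by (rule measurable_compose[OF measurable_Pair[OF n measurable_Pair[OF S T]], of "\<lambda>x. x" state_space]) (simp add: state_space_def)
    qed
    have "(\<lambda>w. PiM ?I (\<lambda>_. gaussian ((fst (snd (fst w)) i + snd w i) / real (fst (fst w) i + 1)) (?L / real (fst (fst w) i + 1))) \<bind>
       (\<lambda>z. return state_space (let (((n,S,\<theta>),X),z) = (w,z) in (n(i := n i + 1), S(i := S i + X i), \<theta>(i := Max (z ` ?I))))))
        \<in> state_space \<Otimes>\<^sub>M reward_vectors K \<rightarrow>\<^sub>M prob_algebra state_space"
      by (rule measurable_bind_prob_space2[OF 1])
         (use measurable_compose[OF 2 measurable_return_prob_space] in \<open>simp add: case_prod_unfold Let_def\<close>)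
    thus ?thesis by (simp add: body_def case_prod_unfold Let_def)
  qed
  have c: "(\<lambda>(s, i). case s of (n,S,\<theta>) \<Rightarrow> \<nu> t \<bind> (\<lambda>X. body i n S \<theta> X)) \<in> state_space \<Otimes>\<^sub>M count_space UNIV \<rightarrow>\<^sub>M prob_algebra state_space"
  proof -
    have "(\<lambda>s. case s of (n,S,\<theta>) \<Rightarrow> \<nu> t \<bind> (\<lambda>X. body i n S \<theta> X)) \<in> state_space \<rightarrow>\<^sub>M prob_algebra state_space" for i
      using measurable_bind_prob_space2[OF measurable_const[OF rewards_in_prob_algebra[of t]], of "\<lambda>s X. case s of (n,S,\<theta>) \<Rightarrow> body i n S \<theta> X" state_space state_space] b[of i]
      by (simp add: case_prod_unfold)
    hence "(\<lambda>w. case fst w of (n,S,\<theta>) \<Rightarrow> \<nu> t \<bind> (\<lambda>X. body i n S \<theta> X)) \<in> state_space \<Otimes>\<^sub>M count_space UNIV \<rightarrow>\<^sub>M prob_algebra state_space" for i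
      by (rule measurable_compose[OF measurable_fst])
    from measurable_compose_countable[OF this measurable_snd] show ?thesis
      by (simp add: case_prod_unfold)
  qed
  have p: "(\<lambda>s. measure_pmf (choose_arm K tie t (snd (snd s)))) \<in> state_space \<rightarrow>\<^sub>M prob_algebra (count_space UNIV)"
    by (rule measurable_compose[OF _ measurable_choose_arm]) (simp add: state_space_def)
  show ?thesis unfolding step
    using measurable_bind_prob_space2[OF p c]
    by (simp add: case_prod_unfold)
qed

lemma ts_ma_run_in_prob_algebra:
  assumes T: "T \<ge> 2"
  shows "ts_ma_run K \<nu> tie T \<alpha> t \<in> space (prob_algebra state_space)"
proof (induction t)
  case 0
  have "(\<lambda>_. 0, \<lambda>_. 0, \<lambda>_. 0) \<in> space state_space" by (simp add: state_space_def space_pair_measure space_PiM)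
  then show ?case by (simp add: space_prob_algebra prob_space_return)
next
  case (Suc t)
  show ?case using prob_space_bind'[OF Suc measurable_ts_ma_step[OF T]] sets_bind'[OF Suc measurable_ts_ma_step[OF T]]
    by (simp add: space_prob_algebra)
qed

end

end

theory Submission
  imports Defs "HOL-Real_Asymp.Real_Asymp"
begin

text \<open>
  Write \<open>L = ln T\<close> and \<open>\<phi>\<close> for the number of samples. For a suboptimal arm \<open>i\<close> with gap \<open>\<Delta>\<close> let
  \<open>U\<close> be of order \<open>L powr (\<alpha> + 1) / \<Delta>\<^sup>2\<close>. After the initialization, arm \<open>i\<close> can be pulled for more than the \<open>U\<close>-th time
  only if the current index of arm 1 is below \<open>\<mu>\<^sub>1\<close> or the current index of arm \<open>i\<close> is at least
  \<open>\<mu>\<^sub>1\<close>. In every round this has probability \<open>O(1 / T)\<close>, so arm \<open>i\<close> is pulled \<open>U + O(1)\<close> times in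
  expectation.

  All estimates are inequalities for a single step of the Markov chain of states, so no table of
  presampled rewards is needed. Deviations of empirical means are controlled through the exponential
  supermartingale \<open>exp (l (S\<^sub>i - n\<^sub>i \<mu>\<^sub>i) - l\<^sup>2 n\<^sub>i / 8)\<close>. The event that an index is bad although the empirical mean
  behind it is good can only arise in a round in which the index is redrawn, so its probability grows
  in each round by at most the probability of a bad draw. For arm 1 the empirical mean is at most
  \<open>sqrt (L / n)\<close>, that is \<open>L powr ((1 - \<alpha>) / 2)\<close> standard deviations, below \<open>\<mu>\<^sub>1\<close>; a Gaussian exceeds
  its mean by that much with probability at least \<open>2 L / \<phi>\<close>, so all \<open>\<phi>\<close> samples stay below \<open>\<mu>\<^sub>1\<close>
  with probability at most \<open>exp (- 2 L) = 1 / T\<^sup>2\<close>.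
\<close>

section \<open>Gaussian tails and maxima of Gaussian samples\<close>

lemma space_gaussian [simp]: "space (gaussian m v) = UNIV"
  by (simp add: gaussian_def)

lemma emeasure_gaussian_atLeast:
  assumes "v > 0"
  shows "emeasure (gaussian m v) {m + sqrt v * x..} = emeasure (gaussian 0 1) {x..}"
proof -
  have "(\<lambda>y. m + sqrt v * y) -` {m + sqrt v * x..} = {x..}"
    using assms by auto
  thus ?thesis
    by (subst gaussian_affine[OF assms]) (simp add: emeasure_distr)
qed

text \<open>For \<open>y >= x >= 0\<close> one has \<open>y^2 >= x^2 + (y - x)^2\<close>. So on the
  tail the standard density is at most \<open>exp (- x^2 / 2)\<close> times the density centered at
  \<open>x\<close>, which has total mass 1.\<close>

lemma gaussian_upper_tail:
  assumes "v > 0" "x \<ge> 0"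
  shows "emeasure (gaussian m v) {m + sqrt v * x..} \<le> ennreal (exp (- (x\<^sup>2 / 2)))"
proof -
  interpret g: prob_space "density lborel (\<lambda>y. ennreal (normal_density x 1 y))"
    by (rule prob_space_normal_density) simp
  have "emeasure (gaussian 0 1) {x..} =
      (\<integral>\<^sup>+y. ennreal (normal_density 0 1 y) * indicator {x..} y \<partial>lborel)"
    by (simp add: gaussian_def emeasure_density)
  also have "\<dots> \<le> (\<integral>\<^sup>+y. ennreal (exp (- (x\<^sup>2 / 2))) * ennreal (normal_density x 1 y) \<partial>lborel)"
  proof (intro nn_integral_mono)
    fix y :: real
    have "normal_density 0 1 y \<le> exp (- (x\<^sup>2 / 2)) * normal_density x 1 y" if "x \<le> y"
    proof -
      have "0 \<le> x * (y - x)" using that assms(2) by simp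
      hence "- (y\<^sup>2) / 2 \<le> - (x\<^sup>2 / 2) + - ((y - x)\<^sup>2) / 2"
        by (simp add: power2_eq_square field_simps)
      hence "exp (- (y\<^sup>2) / 2) \<le> exp (- (x\<^sup>2 / 2)) * exp (- ((y - x)\<^sup>2) / 2)"
        by (simp flip: exp_add)
      thus ?thesis by (simp add: normal_density_def divide_right_mono)
    qed
    thus "ennreal (normal_density 0 1 y) * indicator {x..} y
        \<le> ennreal (exp (- (x\<^sup>2 / 2))) * ennreal (normal_density x 1 y)"
      by (simp add: ennreal_mult[symmetric] ennreal_leI split: split_indicator)
  qed
  also have "\<dots> = ennreal (exp (- (x\<^sup>2 / 2)))"
    using g.emeasure_space_1 by (simp add: nn_integral_cmult emeasure_density)
  finally show ?thesis using assms by (simp add: emeasure_gaussian_atLeast)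
qed

text \<open>The explicit function \<open>F\<close>, which vanishes at infinity, has derivative equal
  to the standard density times \<open>1 / 2 + 1 / (2 * y^2)\<close>. This factor is at most 1 for
  \<open>y >= 1\<close>, so integrating the derivative bounds the tail from below by half of the
  leading term of Mills' ratio.\<close>

lemma gaussian_lower_tail:
  assumes "v > 0" "x \<ge> 1"
  shows "ennreal (exp (- (x\<^sup>2 / 2)) / (2 * x * sqrt (2 * pi)))
    \<le> emeasure (gaussian m v) {m + sqrt v * x..}"
proof -
  define c where "c = sqrt (2 * pi)"
  have c: "c > 0" by (simp add: c_def)
  define F where "F y = - (exp (- (y\<^sup>2 / 2)) / (2 * y * c))" for y :: real
  define f where "f y = exp (- (y\<^sup>2 / 2)) / c * (1 / 2 + 1 / (2 * y\<^sup>2))" for y :: real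
  have F: "(F has_real_derivative f y) (at y)" if "x \<le> y" for y
    unfolding F_def f_def using that assms c
    by (auto intro!: derivative_eq_intros simp: field_simps power2_eq_square)
  have lim: "(F \<longlongrightarrow> 0) at_top"
    unfolding F_def using c by real_asymp
  have "(\<integral>\<^sup>+y. ennreal (f y) * indicator {x..} y \<partial>lborel) = ennreal (0 - F x)"
  proof (rule nn_integral_FTC_atLeast)
    show "f \<in> borel_measurable borel" unfolding f_def by measurable
  qed (use F lim c in \<open>auto simp: f_def\<close>)
  hence "ennreal (exp (- (x\<^sup>2 / 2)) / (2 * x * sqrt (2 * pi))) =
      (\<integral>\<^sup>+y. ennreal (f y) * indicator {x..} y \<partial>lborel)"
    by (simp add: F_def c_def)
  also have "\<dots> \<le> (\<integral>\<^sup>+y. ennreal (normal_density 0 1 y) * indicator {x..} y \<partial>lborel)"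
  proof (intro nn_integral_mono)
    fix y :: real
    have "f y \<le> normal_density 0 1 y" if "x \<le> y"
    proof -
      have "1 \<le> y\<^sup>2" using that assms(2) by (simp add: one_le_power)
      hence "1 / y\<^sup>2 \<le> 1" by (auto simp: divide_le_eq_1)
      hence "1 / 2 + 1 / (2 * y\<^sup>2) \<le> 1" by simp
      hence "f y \<le> exp (- (y\<^sup>2 / 2)) / c * 1"
        unfolding f_def using c by (intro mult_left_mono) auto
      thus ?thesis by (simp add: normal_density_def c_def)
    qed
    thus "ennreal (f y) * indicator {x..} y \<le> ennreal (normal_density 0 1 y) * indicator {x..} y"
      by (simp add: ennreal_leI split: split_indicator)
  qed
  also have "\<dots> = emeasure (gaussian 0 1) {x..}"
    by (simp add: gaussian_def emeasure_density)
  finally show ?thesis using assms by (simp add: emeasure_gaussian_atLeast)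
qed

text \<open>Union bound over the samples. The probability is written as an integral of an indicator,
  the shape in which it occurs inside a step of the chain.\<close>

lemma nn_integral_Max_gaussian_ge:
  assumes "v > 0" "x \<ge> 0" "finite I" "I \<noteq> {}"
  shows "(\<integral>\<^sup>+z. indicator {m + sqrt v * x..} (Max (z ` I)) \<partial>PiM I (\<lambda>_. gaussian m v))
    \<le> ennreal (real (card I) * exp (- (x\<^sup>2 / 2)))"
proof -
  interpret g: prob_space "gaussian m v" by (rule prob_gaussian[OF assms(1)])
  interpret P: product_prob_space "\<lambda>_. gaussian m v" I ..
  let ?c = "m + sqrt v * x"
  have "(\<integral>\<^sup>+z. indicator {?c..} (Max (z ` I)) \<partial>PiM I (\<lambda>_. gaussian m v))
      \<le> (\<integral>\<^sup>+z. (\<Sum>h\<in>I. indicator {?c..} (z h)) \<partial>PiM I (\<lambda>_. gaussian m v))"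
  proof (intro nn_integral_mono)
    fix z :: "'a \<Rightarrow> real"
    show "indicator {?c..} (Max (z ` I)) \<le> (\<Sum>h\<in>I. indicator {?c..} (z h) :: ennreal)"
    proof (cases "?c \<le> Max (z ` I)")
      case True
      then obtain h where h: "h \<in> I" "?c \<le> z h"
        using assms(3,4) by (auto simp: Max_ge_iff)
      have "indicator {?c..} (z h) \<le> (\<Sum>h\<in>I. indicator {?c..} (z h) :: ennreal)"
        using h assms(3) by (intro member_le_sum) auto
      thus ?thesis using True h by simp
    qed simp
  qed
  also have "\<dots> = (\<Sum>h\<in>I. \<integral>\<^sup>+z. indicator {?c..} (z h) \<partial>PiM I (\<lambda>_. gaussian m v))"
    by (intro nn_integral_sum) measurable
  also have "\<dots> = (\<Sum>h\<in>I. emeasure (gaussian m v) {?c..})"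
  proof (intro sum.cong refl)
    fix h assume h: "h \<in> I"
    have "(\<integral>\<^sup>+z. indicator {?c..} (z h) \<partial>PiM I (\<lambda>_. gaussian m v)) =
        (\<integral>\<^sup>+y. indicator {?c..} y \<partial>distr (PiM I (\<lambda>_. gaussian m v)) (gaussian m v) (\<lambda>z. z h))"
      using h by (subst nn_integral_distr) auto
    thus "(\<integral>\<^sup>+z. indicator {?c..} (z h) \<partial>PiM I (\<lambda>_. gaussian m v)) = emeasure (gaussian m v) {?c..}"
      using P.PiM_component[OF h] by simp
  qed
  also have "\<dots> \<le> (\<Sum>h\<in>I. ennreal (exp (- (x\<^sup>2 / 2))))"
    by (intro sum_mono gaussian_upper_tail assms)
  finally show ?thesis by (simp add: ennreal_mult ennreal_of_nat_eq_real_of_nat)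
qed

text \<open>The maximum stays below \<open>c\<close> iff all independent samples do. Each does so
  with probability at most \<open>1 - q\<close>, and \<open>1 - q\<close> is at most
  \<open>exp (- q)\<close>.\<close>

lemma nn_integral_Max_gaussian_less:
  assumes "v > 0" "finite I" "I \<noteq> {}"
    and q: "0 \<le> q" "ennreal q \<le> emeasure (gaussian m v) {c..}"
  shows "(\<integral>\<^sup>+z. indicator {..<c} (Max (z ` I)) \<partial>PiM I (\<lambda>_. gaussian m v))
    \<le> ennreal (exp (- (real (card I) * q)))"
proof -
  interpret g: prob_space "gaussian m v" by (rule prob_gaussian[OF assms(1)])
  interpret P: product_prob_space "\<lambda>_. gaussian m v" I ..
  have "q \<le> g.prob {c..}" using q by (simp add: g.emeasure_eq_measure)
  moreover have "g.prob {..<c} = 1 - g.prob {c..}"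
    using g.prob_compl[of "{c..}"] by (simp add: Compl_eq_Diff_UNIV[symmetric])
  ultimately have le: "g.prob {..<c} \<le> exp (- q)"
    using exp_ge_add_one_self[of "- q"] by simp
  have "(\<integral>\<^sup>+z. indicator {..<c} (Max (z ` I)) \<partial>PiM I (\<lambda>_. gaussian m v)) =
      (\<integral>\<^sup>+z. indicator (Pi\<^sub>E I (\<lambda>_. {..<c})) z \<partial>PiM I (\<lambda>_. gaussian m v))"
    using assms(2,3) by (intro nn_integral_cong) (auto simp: space_PiM PiE_def Pi_def split: split_indicator)
  also have "\<dots> = emeasure (PiM I (\<lambda>_. gaussian m v)) (Pi\<^sub>E I (\<lambda>_. {..<c}))"
    using assms(2) by (intro nn_integral_indicator sets_PiM_I_finite) auto
  also have "\<dots> = (\<Prod>h\<in>I. emeasure (gaussian m v) {..<c})"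
    using assms(2) by (intro P.emeasure_PiM) auto
  also have "\<dots> = ennreal (g.prob {..<c} ^ card I)"
    by (simp add: g.emeasure_eq_measure ennreal_power)
  also have "\<dots> \<le> ennreal (exp (- q) ^ card I)"
    by (intro ennreal_leI power_mono le) simp
  also have "exp (- q) ^ card I = exp (- (real (card I) * q))"
    by (simp add: exp_of_nat_mult[symmetric])
  finally show ?thesis .
qed

section \<open>The Markov chain of states\<close>

lemma measurable_state [measurable]:
  "(\<lambda>s. fst s i) \<in> state_space \<rightarrow>\<^sub>M count_space UNIV"
  "(\<lambda>s. fst (snd s) i) \<in> state_space \<rightarrow>\<^sub>M borel"
  "(\<lambda>s. snd (snd s) i) \<in> state_space \<rightarrow>\<^sub>M borel"
  unfolding state_space_def by measurable

lemma space_state_space [simp]: "space state_space = UNIV"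
  by (auto simp: state_space_def space_pair_measure space_PiM)

locale ts_ma = stochastic_bandit +
  fixes tie :: "nat \<Rightarrow> nat set \<Rightarrow> nat pmf" and T :: nat and \<alpha> :: real
  assumes tie: "tie_breaking K tie" and T: "T \<ge> 2" and \<alpha>: "0 \<le> \<alpha>" "\<alpha> \<le> 1"
begin

abbreviation "samples \<equiv> {1..num_samples T \<alpha>}"
abbreviation "law \<equiv> ts_ma_run K \<nu> tie T \<alpha>"
abbreviation "\<mu> \<equiv> arm_mean p"
abbreviation "L \<equiv> ln (real T)"

text \<open>At \<open>n = 0\<close> the variance divides by zero, hence the hypothesis
  \<open>n > 0\<close> in the facts below. The chain only draws after increasing the count, so it
  only meets \<open>n + 1\<close>.\<close>

definition sample_law :: "real \<Rightarrow> nat \<Rightarrow> (nat \<Rightarrow> real) measure" where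
  "sample_law S n = PiM samples (\<lambda>_. gaussian (S / real n) (L powr \<alpha> / real n))"

lemma ln_T_pos: "L > 0" using T by simp

lemma prob_sample_law: "n > 0 \<Longrightarrow> prob_space (sample_law S n)"
  unfolding sample_law_def using ln_T_pos by (intro prob_space_PiM prob_gaussian) simp

lemma emeasure_space_sample_law:
  "n > 0 \<Longrightarrow> emeasure (sample_law S n) (space (sample_law S n)) = 1"
  using prob_space.emeasure_space_1[OF prob_sample_law] .

lemma sets_sample_law [measurable_cong]: "sets (sample_law S n) = sets (PiM samples (\<lambda>_. borel))"
  unfolding sample_law_def by (intro sets_PiM_cong) auto

lemma measurable_update:
  "(\<lambda>(X, z). (n(i := n i + 1), S(i := S i + X i), \<theta>(i := Max (z ` samples))))
    \<in> reward_vectors K \<Otimes>\<^sub>M PiM samples (\<lambda>_. borel) \<rightarrow>\<^sub>M state_space"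
proof -
  let ?W = "reward_vectors K \<Otimes>\<^sub>M PiM samples (\<lambda>_. borel :: real measure)"
  have X: "(\<lambda>w. fst w i) \<in> ?W \<rightarrow>\<^sub>M borel"
    by (rule measurable_compose[OF measurable_fst measurable_reward])
  have M: "(\<lambda>w. Max (snd w ` samples)) \<in> ?W \<rightarrow>\<^sub>M borel"
  proof -
    have "(\<lambda>z. Max ((\<lambda>h. z h) ` samples)) \<in> PiM samples (\<lambda>_. borel :: real measure) \<rightarrow>\<^sub>M borel"
      by (rule borel_measurable_Max) auto
    from measurable_compose[OF measurable_snd this] show ?thesis by simp
  qed
  have S: "(\<lambda>w. S(i := S i + fst w i)) \<in> ?W \<rightarrow>\<^sub>M PiM UNIV (\<lambda>_. borel)"
  proof (rule measurable_PiM_single')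
    show "(\<lambda>w. (S(i := S i + fst w i)) j) \<in> ?W \<rightarrow>\<^sub>M borel" for j
      using X by (cases "j = i") simp_all
  qed simp
  have \<theta>: "(\<lambda>w. \<theta>(i := Max (snd w ` samples))) \<in> ?W \<rightarrow>\<^sub>M PiM UNIV (\<lambda>_. borel)"
  proof (rule measurable_PiM_single')
    show "(\<lambda>w. (\<theta>(i := Max (snd w ` samples))) j) \<in> ?W \<rightarrow>\<^sub>M borel" for j
      using M by (cases "j = i") simp_all
  qed simp
  have n: "(\<lambda>w. n(i := n i + 1)) \<in> ?W \<rightarrow>\<^sub>M PiM UNIV (\<lambda>_. count_space UNIV)"
    by (rule measurable_const) (simp add: space_PiM)
  show ?thesis
    unfolding state_space_def case_prod_unfold by (intro measurable_Pair n S \<theta>)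
qed

lemma measurable_sample_law:
  "(\<lambda>X. sample_law (S + X i) (n + 1)) \<in> reward_vectors K \<rightarrow>\<^sub>M prob_algebra (PiM samples (\<lambda>_. borel))"
  unfolding sample_law_def
proof (rule measurable_PiM_gaussian)
  show "(\<lambda>X. (S + X i) / real (n + 1)) \<in> borel_measurable (reward_vectors K)"
    by (intro borel_measurable_divide borel_measurable_add measurable_reward) auto
qed (use ln_T_pos in auto)

text \<open>Each bind of the step turns into an integral once its kernel is known to be measurable.
  All later work on a step goes through this iterated integral over arm, reward vector and
  samples.\<close>

lemma nn_integral_step:
  assumes f: "f \<in> borel_measurable state_space"
  shows "(\<integral>\<^sup>+s. f s \<partial>ts_ma_step K \<nu> tie T \<alpha> t (n, S, \<theta>)) =
    (\<integral>\<^sup>+i. \<integral>\<^sup>+X. \<integral>\<^sup>+z. f (n(i := n i + 1), S(i := S i + X i), \<theta>(i := Max (z ` samples)))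
       \<partial>sample_law (S i + X i) (n i + 1) \<partial>\<nu> t \<partial>choose_arm K tie t \<theta>)"
proof -
  define upd where "upd i X z = (n(i := n i + 1), S(i := S i + X i), \<theta>(i := Max (z ` samples)))"
    for i and X z :: "nat \<Rightarrow> real"
  have upd: "(\<lambda>(X, z). upd i X z) \<in> reward_vectors K \<Otimes>\<^sub>M PiM samples (\<lambda>_. borel) \<rightarrow>\<^sub>M state_space" for i
    unfolding upd_def by (rule measurable_update)
  have upd': "upd i X \<in> PiM samples (\<lambda>_. borel) \<rightarrow>\<^sub>M state_space" if "X \<in> space (reward_vectors K)" for i X
    using measurable_compose[OF measurable_Pair1'[OF that] upd[of i]] by simp
  define kern where "kern i X = sample_law (S i + X i) (n i + 1) \<bind> (\<lambda>z. return state_space (upd i X z))" for i X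
  have kern: "kern i \<in> reward_vectors K \<rightarrow>\<^sub>M prob_algebra state_space" for i
    unfolding kern_def
    by (rule measurable_bind_prob_space2[OF measurable_sample_law])
       (use measurable_compose[OF upd measurable_return_prob_space] in \<open>simp add: case_prod_unfold\<close>)
  \<comment> \<open>Arms carry the discrete sigma-algebra, so it is enough that each value is a
    probability measure.\<close>
  have kern_nu: "(\<lambda>i. \<nu> t \<bind> kern i) \<in> count_space UNIV \<rightarrow>\<^sub>M prob_algebra state_space"
    using prob_space_bind'[OF rewards_in_prob_algebra kern] sets_bind'[OF rewards_in_prob_algebra kern]
    by (auto simp: space_prob_algebra)
  have step: "ts_ma_step K \<nu> tie T \<alpha> t (n, S, \<theta>) = measure_pmf (choose_arm K tie t \<theta>) \<bind> (\<lambda>i. \<nu> t \<bind> kern i)"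
    by (simp add: ts_ma_step_def kern_def[abs_def] upd_def sample_law_def Let_def)
  have sets_nu [measurable_cong]: "sets (\<nu> t) = sets (reward_vectors K)" by (rule sets_rewards)
  have "(\<integral>\<^sup>+s. f s \<partial>ts_ma_step K \<nu> tie T \<alpha> t (n, S, \<theta>)) =
      (\<integral>\<^sup>+i. \<integral>\<^sup>+X. \<integral>\<^sup>+s. f s \<partial>kern i X \<partial>\<nu> t \<partial>choose_arm K tie t \<theta>)"
    unfolding step
  proof (subst nn_integral_bind[OF f])
    show "(\<lambda>i. \<nu> t \<bind> kern i) \<in> measure_pmf (choose_arm K tie t \<theta>) \<rightarrow>\<^sub>M subprob_algebra state_space"
      using measurable_prob_algebraD[OF kern_nu] by simp
    have "kern i \<in> \<nu> t \<rightarrow>\<^sub>M subprob_algebra state_space" for i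
      using measurable_prob_algebraD[OF kern] by measurable
    thus "(\<integral>\<^sup>+i. \<integral>\<^sup>+s. f s \<partial>(\<nu> t \<bind> kern i) \<partial>choose_arm K tie t \<theta>) =
        (\<integral>\<^sup>+i. \<integral>\<^sup>+X. \<integral>\<^sup>+s. f s \<partial>kern i X \<partial>\<nu> t \<partial>choose_arm K tie t \<theta>)"
      by (intro nn_integral_cong nn_integral_bind[OF f])
  qed
  also have "(\<integral>\<^sup>+s. f s \<partial>kern i X) =
      (\<integral>\<^sup>+z. f (upd i X z) \<partial>sample_law (S i + X i) (n i + 1))" if "X \<in> space (\<nu> t)" for i X
  proof -
    have [measurable]: "upd i X \<in> PiM samples (\<lambda>_. borel) \<rightarrow>\<^sub>M state_space"
      using upd' that sets_eq_imp_space_eq[OF sets_nu] by auto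
    have "(\<lambda>z. return state_space (upd i X z)) \<in> sample_law (S i + X i) (n i + 1) \<rightarrow>\<^sub>M subprob_algebra state_space"
      by measurable
    thus ?thesis
      unfolding kern_def using f by (simp add: nn_integral_bind[OF f] nn_integral_return)
  qed
  hence "(\<integral>\<^sup>+i. \<integral>\<^sup>+X. \<integral>\<^sup>+s. f s \<partial>kern i X \<partial>\<nu> t \<partial>choose_arm K tie t \<theta>) =
     (\<integral>\<^sup>+i. \<integral>\<^sup>+X. \<integral>\<^sup>+z. f (upd i X z) \<partial>sample_law (S i + X i) (n i + 1) \<partial>\<nu> t \<partial>choose_arm K tie t \<theta>)"
    by (intro nn_integral_cong)
  finally show ?thesis by (simp add: upd_def)
qed

lemma sets_law [measurable_cong]: "sets (law t) = sets state_space"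
  and prob_law: "prob_space (law t)"
  using ts_ma_run_in_prob_algebra[OF T] by (auto simp: space_prob_algebra)

lemma space_law [simp]: "space (law t) = UNIV"
  using sets_eq_imp_space_eq[OF sets_law] by simp

lemma measurable_step:
  "ts_ma_step K \<nu> tie T \<alpha> t' \<in> law t \<rightarrow>\<^sub>M subprob_algebra state_space"
  using measurable_prob_algebraD[OF measurable_ts_ma_step[OF T]] by measurable

lemma nn_integral_law_Suc:
  assumes "f \<in> borel_measurable state_space"
  shows "(\<integral>\<^sup>+s. f s \<partial>law (Suc t)) = (\<integral>\<^sup>+s. \<integral>\<^sup>+s'. f s' \<partial>ts_ma_step K \<nu> tie T \<alpha> (Suc t) s \<partial>law t)"
  unfolding ts_ma_run.simps by (rule nn_integral_bind[OF assms measurable_step])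

lemma nn_integral_law_0:
  assumes "f \<in> borel_measurable state_space"
  shows "(\<integral>\<^sup>+s. f s \<partial>law 0) = f (\<lambda>_. 0, \<lambda>_. 0, \<lambda>_. 0)"
  using assms by (simp add: nn_integral_return)

text \<open>The transition operator, applied to \<open>g\<close>, of the triple (count, reward sum,
  index) of arm \<open>i\<close> when that arm is pulled. The old index is no argument because a
  pull overwrites it.\<close>

definition pull :: "nat \<Rightarrow> (nat \<Rightarrow> real \<Rightarrow> real \<Rightarrow> ennreal) \<Rightarrow> nat \<Rightarrow> nat \<Rightarrow> real \<Rightarrow> ennreal" where
  "pull t g i n S =
     (\<integral>\<^sup>+X. \<integral>\<^sup>+z. g (n + 1) (S + X i) (Max (z ` samples)) \<partial>sample_law (S + X i) (n + 1) \<partial>\<nu> t)"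

text \<open>A step touches only the chosen arm: the triple of arm \<open>i\<close> moves by
  \<open>pull\<close> if \<open>i\<close> is chosen and stands still otherwise.\<close>

lemma nn_integral_step_arm:
  assumes "(\<lambda>s. g (fst s i) (fst (snd s) i) (snd (snd s) i)) \<in> borel_measurable state_space"
  shows "(\<integral>\<^sup>+s. g (fst s i) (fst (snd s) i) (snd (snd s) i) \<partial>ts_ma_step K \<nu> tie T \<alpha> t (n, S, \<theta>)) =
    (\<integral>\<^sup>+j. (if j = i then pull t g i (n i) (S i) else g (n i) (S i) (\<theta> i)) \<partial>choose_arm K tie t \<theta>)"
proof -
  interpret \<nu>: prob_space "\<nu> t" by (rule prob_rewards)
  show ?thesis
    by (subst nn_integral_step[OF assms], rule nn_integral_cong)
       (simp add: pull_def emeasure_space_sample_law \<nu>.emeasure_space_1)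
qed

lemma pull_sample_free:
  "pull t (\<lambda>n S _. g n S) i n S = (\<integral>\<^sup>+X. g (n + 1) (S + X i) \<partial>\<nu> t)"
  by (simp add: pull_def emeasure_space_sample_law)

lemma measurable_nu_component: "(\<lambda>X. X i) \<in> \<nu> t \<rightarrow>\<^sub>M borel"
  using measurable_reward[of i] measurable_cong_sets[OF sets_rewards refl] by blast

lemma nn_integral_reward:
  assumes "i \<in> {1..K}" "g \<in> borel_measurable borel"
  shows "(\<integral>\<^sup>+X. g (X i) \<partial>\<nu> t) = (\<integral>\<^sup>+x. g x \<partial>p i)"
  using assms measurable_nu_component
  by (subst marginal[OF assms(1), symmetric, of t]) (simp add: nn_integral_distr)

lemma AE_choose_arm: "t \<ge> 1 \<Longrightarrow> AE i in measure_pmf (choose_arm K tie t \<theta>). i \<in> {1..K}"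
  and AE_choose_arm_max: "t > K \<Longrightarrow> AE i in measure_pmf (choose_arm K tie t \<theta>). i \<in> argmax_arms K \<theta>"
proof -
  have sub: "argmax_arms K \<theta> \<subseteq> {1..K}"
    by (auto simp: argmax_arms_def is_arg_max_def)
  have "argmax_arms K \<theta> \<noteq> {}"
  proof -
    have "Max (\<theta> ` {1..K}) \<in> \<theta> ` {1..K}"
      using two_arms by (intro Max_in) auto
    then obtain i where i: "i \<in> {1..K}" "Max (\<theta> ` {1..K}) = \<theta> i" by blast
    have "\<theta> j \<le> \<theta> i" if "j \<in> {1..K}" for j
      using that unfolding i(2)[symmetric] by (intro Max_ge) auto
    hence "i \<in> argmax_arms K \<theta>"
      using i(1) by (auto simp: argmax_arms_def is_arg_max_def not_less)
    thus ?thesis by blast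
  qed
  hence set: "set_pmf (tie t (argmax_arms K \<theta>)) \<subseteq> argmax_arms K \<theta>"
    using tie sub unfolding tie_breaking_def by blast
  show "AE i in measure_pmf (choose_arm K tie t \<theta>). i \<in> argmax_arms K \<theta>" if "t > K"
    using set that by (auto simp: AE_measure_pmf_iff choose_arm_def)
  show "AE i in measure_pmf (choose_arm K tie t \<theta>). i \<in> {1..K}" if "t \<ge> 1"
    using set sub that by (auto simp: AE_measure_pmf_iff choose_arm_def)
qed

section \<open>Almost sure bounds on rewards and invariants of the run\<close>

lemma AE_arm: "i \<in> {1..K} \<Longrightarrow> AE x in p i. x \<in> {0..1}"
proof -
  assume i: "i \<in> {1..K}"
  interpret prob_space "p i" by (rule prob_arm[OF i])
  show ?thesis
    using supported[OF i] sets_arm[OF i] by (intro AE_prob_1) simp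
qed

lemma AE_reward: "i \<in> {1..K} \<Longrightarrow> AE X in \<nu> t. X i \<in> {0..1}"
proof -
  assume i: "i \<in> {1..K}"
  have "AE x in distr (\<nu> t) borel (\<lambda>X. X i). x \<in> {0..1}"
    by (subst marginal[OF i]) (rule AE_arm[OF i])
  thus ?thesis by (subst (asm) AE_distr_iff) (auto intro: measurable_nu_component)
qed

text \<open>The probability of violating \<open>P\<close> is an iterated integral that vanishes as
  soon as \<open>P\<close> holds for every supported arm and every reward in the unit interval. This
  makes invariants checkable by hand; the new index \<open>z\<close> is left arbitrary.\<close>

lemma AE_step:
  assumes [measurable]: "Measurable.pred state_space P"
    and P: "\<And>i X z. i \<in> set_pmf (choose_arm K tie t \<theta>) \<Longrightarrow> X i \<in> {0..1} \<Longrightarrow>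
      P (n(i := n i + 1), S(i := S i + X i), \<theta>(i := z))" and t: "t \<ge> 1"
  shows "AE s in ts_ma_step K \<nu> tie T \<alpha> t (n, S, \<theta>). P s"
proof -
  let ?N = "ts_ma_step K \<nu> tie T \<alpha> t (n, S, \<theta>)"
  have sets [measurable_cong]: "sets ?N = sets state_space"
    using measurable_space[OF measurable_ts_ma_step[OF T, of tie \<alpha> t], of "(n, S, \<theta>)"]
    by (simp add: space_prob_algebra)
  have sp: "space ?N = UNIV" using sets_eq_imp_space_eq[OF sets] by simp
  have "(\<integral>\<^sup>+s. indicator {s. \<not> P s} s \<partial>?N) = (\<integral>\<^sup>+i. 0 \<partial>choose_arm K tie t \<theta>)"
  proof (subst nn_integral_step)
    have "{s \<in> space state_space. \<not> P s} \<in> sets state_space" by measurable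
    thus "indicator {s. \<not> P s} \<in> borel_measurable state_space" by simp
    show "(\<integral>\<^sup>+i. \<integral>\<^sup>+X. \<integral>\<^sup>+z. indicator {s. \<not> P s} (n(i := n i + 1), S(i := S i + X i), \<theta>(i := Max (z ` samples)))
       \<partial>sample_law (S i + X i) (n i + 1) \<partial>\<nu> t \<partial>choose_arm K tie t \<theta>) = (\<integral>\<^sup>+i. 0 \<partial>choose_arm K tie t \<theta>)"
    proof (rule nn_integral_cong_AE, unfold AE_measure_pmf_iff, safe)
      fix i assume i: "i \<in> set_pmf (choose_arm K tie t \<theta>)"
      with AE_choose_arm[OF t, of \<theta>] have "i \<in> {1..K}" by (simp add: AE_measure_pmf_iff)
      hence "AE X in \<nu> t. X i \<in> {0..1}" by (rule AE_reward)
      hence "(\<integral>\<^sup>+X. \<integral>\<^sup>+z. indicator {s. \<not> P s} (n(i := n i + 1), S(i := S i + X i), \<theta>(i := Max (z ` samples)))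
         \<partial>sample_law (S i + X i) (n i + 1) \<partial>\<nu> t) = (\<integral>\<^sup>+X. 0 \<partial>\<nu> t)"
        by (rule nn_integral_cong_AE[OF eventually_mono]) (use P[OF i] in simp)
      thus "(\<integral>\<^sup>+X. \<integral>\<^sup>+z. indicator {s. \<not> P s} (n(i := n i + 1), S(i := S i + X i), \<theta>(i := Max (z ` samples)))
         \<partial>sample_law (S i + X i) (n i + 1) \<partial>\<nu> t) = 0" by simp
    qed
  qed
  moreover have "{s \<in> space ?N. \<not> P s} \<in> sets ?N" by measurable
  ultimately have "emeasure ?N {s \<in> space ?N. \<not> P s} = 0"
    using sp nn_integral_indicator[of "{s. \<not> P s}" ?N] by simp
  thus ?thesis by (subst AE_iff_measurable[OF _ refl]) measurable
qed

text \<open>An invariant of the run. Its last conjunct holds because round 1 is an initialization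
  round and pulls arm 1, so the index of arm 1 is a genuine draw from then on.\<close>

definition reachable :: "nat \<Rightarrow> state \<Rightarrow> bool" where
  "reachable t s \<longleftrightarrow> (\<forall>i\<in>{1..K}. 0 \<le> fst (snd s) i \<and> fst (snd s) i \<le> real (fst s i)) \<and>
     (\<Sum>i\<in>{1..K}. fst s i) = t \<and> (t \<ge> 1 \<longrightarrow> fst s 1 \<ge> 1)"

lemma AE_reachable: "AE s in law t. reachable t s"
proof (induction t)
  case 0
  have "Measurable.pred state_space (reachable 0)"
    unfolding reachable_def by measurable
  hence "(AE s in law 0. reachable 0 s) \<longleftrightarrow> reachable 0 (\<lambda>_. 0, \<lambda>_. 0, \<lambda>_. 0)"
    unfolding ts_ma_run.simps by (intro AE_return) simp
  thus ?case by (simp add: reachable_def del: ts_ma_run.simps)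
next
  case (Suc t)
  have pred: "Measurable.pred state_space (reachable (Suc t))"
    unfolding reachable_def by measurable
  have "AE s' in ts_ma_step K \<nu> tie T \<alpha> (Suc t) s. reachable (Suc t) s'" if "reachable t s" for s
  proof -
    obtain n S \<theta> where s: "s = (n, S, \<theta>)" by (cases s)
    have 1: "n 1 \<ge> 1" if "t \<ge> 1"
      using \<open>reachable t s\<close> that by (auto simp: reachable_def s)
    have choose1: "i = 1" if "i \<in> set_pmf (choose_arm K tie (Suc t) \<theta>)" "t = 0" for i
      using that two_arms by (auto simp: choose_arm_def)
    show ?thesis unfolding s
    proof (rule AE_step[OF pred])
      fix i X z assume i: "i \<in> set_pmf (choose_arm K tie (Suc t) \<theta>)" and X: "X i \<in> {0..1::real}"
      have iK: "i \<in> {1..K}"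
        using i AE_choose_arm[of "Suc t" \<theta>] by (simp add: AE_measure_pmf_iff)
      have "(\<Sum>j\<in>{1..K}. (n(i := n i + 1)) j) = (\<Sum>j\<in>{1..K}. n j + (if j = i then 1 else 0))"
        by (intro sum.cong) auto
      also have "\<dots> = Suc t"
        using iK \<open>reachable t s\<close> by (simp add: sum.distrib reachable_def s)
      finally have sum: "(\<Sum>j\<in>{1..K}. (n(i := n i + 1)) j) = Suc t" .
      have "0 \<le> (S(i := S i + X i)) j \<and> (S(i := S i + X i)) j \<le> real ((n(i := n i + 1)) j)" if "j \<in> {1..K}" for j
        using \<open>reachable t s\<close> X that by (force simp: reachable_def s)
      moreover have "(n(i := n i + 1)) 1 \<ge> 1"
        using 1 choose1[OF i] by (cases "t = 0") auto
      ultimately show "reachable (Suc t) (n(i := n i + 1), S(i := S i + X i), \<theta>(i := z))"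
        unfolding reachable_def fst_conv snd_conv using sum by blast
    qed simp
  qed
  with Suc have "AE s in law t. AE s' in ts_ma_step K \<nu> tie T \<alpha> (Suc t) s. reachable (Suc t) s'"
    by (auto elim: eventually_mono)
  thus ?case
    unfolding ts_ma_run.simps by (subst AE_bind[OF measurable_step pred])
qed

end

section \<open>Concentration along the run\<close>

text \<open>Hoeffding's lemma for exponents of both signs: a negative \<open>l\<close> is handled by
  applying the positive case to \<open>- x\<close>, which lies between -1 and 0.\<close>

lemma nn_integral_exp_centered_le:
  fixes M :: "real measure"
  assumes "prob_space M" and [measurable_cong]: "sets M = sets borel" and X: "AE x in M. x \<in> {0..1::real}"
  shows "(\<integral>\<^sup>+x. ennreal (exp (l * (x - (\<integral>x. x \<partial>M)))) \<partial>M) \<le> ennreal (exp (l\<^sup>2 / 8))"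
proof -
  interpret prob_space M by fact
  consider "l > 0" | "l = 0" | "l < 0" by linarith
  thus ?thesis
  proof cases
    case 1
    interpret interval_bounded_random_variable M "\<lambda>x. x" 0 1
      by unfold_locales (use X in auto)
    show ?thesis using Hoeffdings_lemma_nn_integral[OF 1] by simp
  next
    case 2
    thus ?thesis by (simp add: emeasure_space_1)
  next
    case 3
    interpret interval_bounded_random_variable M "\<lambda>x. - x" "-1" 0
      by unfold_locales (use X in auto)
    have "- l > 0" using 3 by simp
    from Hoeffdings_lemma_nn_integral[OF this] show ?thesis by (simp add: algebra_simps)
  qed
qed

text \<open>Pointwise form of the Chernoff bound: where \<open>c \<le> y\<close> holds, the
  right-hand side dominates an indicator.\<close>

lemma one_le_ennreal_exp_mult:
  assumes "c \<le> y"
  shows "1 \<le> ennreal (exp (- c)) * ennreal (exp y)"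
  using assms by (simp flip: ennreal_mult exp_add add: one_le_exp_iff)

context ts_ma begin

text \<open>Drift inequality for the chain: one-step increments add up over the rounds. The
  increment may be bounded on reachable states only, since the law is concentrated on them.\<close>

lemma nn_integral_law_growth:
  assumes [measurable]: "f \<in> borel_measurable state_space"
    and step: "\<And>t s. reachable t s \<Longrightarrow> (\<integral>\<^sup>+s'. f s' \<partial>ts_ma_step K \<nu> tie T \<alpha> (Suc t) s) \<le> f s + \<delta> (Suc t)"
  shows "(\<integral>\<^sup>+s. f s \<partial>law t) \<le> f (\<lambda>_. 0, \<lambda>_. 0, \<lambda>_. 0) + (\<Sum>u\<in>{1..t}. \<delta> u)"
proof (induction t)
  case 0
  show ?case by (subst nn_integral_law_0) simp_all
next
  case (Suc t)
  interpret prob_space "law t" by (rule prob_law)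
  have "(\<integral>\<^sup>+s. f s \<partial>law (Suc t)) = (\<integral>\<^sup>+s. \<integral>\<^sup>+s'. f s' \<partial>ts_ma_step K \<nu> tie T \<alpha> (Suc t) s \<partial>law t)"
    by (rule nn_integral_law_Suc) fact
  also have "\<dots> \<le> (\<integral>\<^sup>+s. f s + \<delta> (Suc t) \<partial>law t)"
    by (rule nn_integral_mono_AE[OF eventually_mono[OF AE_reachable]]) (rule step)
  also have "\<dots> = (\<integral>\<^sup>+s. f s \<partial>law t) + \<delta> (Suc t)"
    by (subst nn_integral_add) (auto simp: emeasure_space_1 simp del: space_law)
  also have "\<dots> \<le> f (\<lambda>_. 0, \<lambda>_. 0, \<lambda>_. 0) + (\<Sum>u\<in>{1..t}. \<delta> u) + \<delta> (Suc t)"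
    by (intro add_right_mono Suc)
  finally show ?case by (simp add: add.assoc)
qed

text \<open>If \<open>g\<close> looks at a single arm, it is enough to control a pull of that arm,
  since otherwise its value does not change. The rule that selects arms therefore does not
  enter.\<close>

lemma nn_integral_law_arm_growth:
  assumes "(\<lambda>s. g (fst s i) (fst (snd s) i) (snd (snd s) i)) \<in> borel_measurable state_space"
    and pull: "\<And>t n S \<theta>. pull t g i n S \<le> g n S \<theta> + \<delta>"
  shows "(\<integral>\<^sup>+s. g (fst s i) (fst (snd s) i) (snd (snd s) i) \<partial>law t) \<le> g 0 0 0 + of_nat t * \<delta>"
proof -
  have "(\<integral>\<^sup>+s. g (fst s i) (fst (snd s) i) (snd (snd s) i) \<partial>law t)
      \<le> g 0 0 0 + (\<Sum>u\<in>{1..t}. \<delta>)"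
  proof (rule order.trans[OF nn_integral_law_growth[where \<delta> = "\<lambda>_. \<delta>", OF assms(1)]])
    fix t and s :: state
    obtain n S \<theta> where s: "s = (n, S, \<theta>)" by (cases s)
    have "(\<integral>\<^sup>+j. (if j = i then pull (Suc t) g i (n i) (S i) else g (n i) (S i) (\<theta> i)) \<partial>choose_arm K tie (Suc t) \<theta>)
      \<le> (\<integral>\<^sup>+j. g (n i) (S i) (\<theta> i) + \<delta> \<partial>choose_arm K tie (Suc t) \<theta>)"
      by (intro nn_integral_mono) (simp add: pull)
    thus "(\<integral>\<^sup>+s'. g (fst s' i) (fst (snd s') i) (snd (snd s') i) \<partial>ts_ma_step K \<nu> tie T \<alpha> (Suc t) s)
        \<le> g (fst s i) (fst (snd s) i) (snd (snd s) i) + \<delta>"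
      unfolding s by (subst nn_integral_step_arm[OF assms(1)]) simp
  qed simp
  thus ?thesis by simp
qed

text \<open>By Hoeffding's lemma the integrand is a supermartingale, whatever the rule by which the arms
  are selected.\<close>

lemma nn_integral_exp_deviation:
  assumes i: "i \<in> {1..K}"
  shows "(\<integral>\<^sup>+s. ennreal (exp (l * (fst (snd s) i - real (fst s i) * \<mu> i) - l\<^sup>2 * real (fst s i) / 8)) \<partial>law t) \<le> 1"
proof -
  define g where "g n S = ennreal (exp (l * (S - real n * \<mu> i) - l\<^sup>2 * real n / 8))" for n S
  interpret p: prob_space "p i" by (rule prob_arm[OF i])
  have "pull t (\<lambda>n S _. g n S) i n S \<le> g n S + 0" for t n S
  proof -
    have [measurable_cong]: "sets (p i) = sets borel" by (rule sets_arm[OF i])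
    have "pull t (\<lambda>n S _. g n S) i n S = (\<integral>\<^sup>+x. g (n + 1) (S + x) \<partial>p i)"
      unfolding pull_sample_free by (rule nn_integral_reward[OF i]) (simp add: g_def)
    also have "\<dots> = (\<integral>\<^sup>+x. g n S * ennreal (exp (- (l\<^sup>2 / 8))) * ennreal (exp (l * (x - \<mu> i))) \<partial>p i)"
      unfolding g_def by (simp flip: ennreal_mult exp_add add: algebra_simps add_divide_distrib)
    also have "\<dots> = g n S * ennreal (exp (- (l\<^sup>2 / 8))) * (\<integral>\<^sup>+x. ennreal (exp (l * (x - \<mu> i))) \<partial>p i)"
      by (rule nn_integral_cmult) measurable
    also have "\<dots> \<le> g n S * ennreal (exp (- (l\<^sup>2 / 8))) * ennreal (exp (l\<^sup>2 / 8))"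
      using nn_integral_exp_centered_le[OF p.prob_space_axioms sets_arm[OF i] AE_arm[OF i], of l]
      by (intro mult_left_mono) (simp_all add: arm_mean_def)
    also have "\<dots> = g n S"
      by (simp add: mult.assoc flip: ennreal_mult exp_add)
    finally show ?thesis by simp
  qed
  from nn_integral_law_arm_growth[of "\<lambda>n S _. g n S" i 0, OF _ this, of t]
  have "(\<integral>\<^sup>+s. g (fst s i) (fst (snd s) i) \<partial>law t) \<le> g 0 0"
    by (simp add: g_def)
  thus ?thesis by (simp add: g_def)
qed

text \<open>The threshold is linear in the count, so one exponent \<open>l\<close> serves all counts
  at least \<open>U\<close> at once and no union over counts is taken.\<close>

lemma upper_deviation:
  assumes i: "i \<in> {1..K}" and d: "d > 0"
  shows "emeasure (law t) {s. U \<le> fst s i \<and> real (fst s i) * (\<mu> i + d) < fst (snd s) i}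
    \<le> ennreal (exp (- (2 * d\<^sup>2 * real U)))"
proof -
  let ?B = "{s. U \<le> fst s i \<and> real (fst s i) * (\<mu> i + d) < fst (snd s) i}"
  \<comment> \<open>The choice \<open>l = 4 * d\<close> maximizes \<open>l * d - l^2 / 8\<close>,
    with value \<open>2 * d^2\<close>.\<close>
  define W :: "state \<Rightarrow> ennreal"
    where "W s = ennreal (exp (4 * d * (fst (snd s) i - real (fst s i) * \<mu> i) - (4 * d)\<^sup>2 * real (fst s i) / 8))" for s
  have [measurable]: "W \<in> borel_measurable (law t)" unfolding W_def by measurable
  have "{s \<in> space (law t). s \<in> ?B} \<in> sets (law t)" unfolding mem_Collect_eq by measurable
  hence "emeasure (law t) ?B = (\<integral>\<^sup>+s. indicator ?B s \<partial>law t)" by simp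
  also have "\<dots> \<le> (\<integral>\<^sup>+s. ennreal (exp (- (2 * d\<^sup>2 * real U))) * W s \<partial>law t)"
  proof (intro nn_integral_mono)
    fix s
    have "1 \<le> ennreal (exp (- (2 * d\<^sup>2 * real U))) * W s" if "s \<in> ?B"
      unfolding W_def
    proof (rule one_le_ennreal_exp_mult)
      have "4 * d * (real (fst s i) * d) \<le> 4 * d * (fst (snd s) i - real (fst s i) * \<mu> i)"
        using that d by (intro mult_left_mono) (auto simp: algebra_simps)
      moreover have "2 * d\<^sup>2 * real U \<le> 2 * d\<^sup>2 * real (fst s i)"
        using that by (intro mult_left_mono) auto
      ultimately show "2 * d\<^sup>2 * real U \<le> 4 * d * (fst (snd s) i - real (fst s i) * \<mu> i) - (4 * d)\<^sup>2 * real (fst s i) / 8"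
        by (simp add: power2_eq_square algebra_simps)
    qed
    thus "indicator ?B s \<le> ennreal (exp (- (2 * d\<^sup>2 * real U))) * W s"
      by (simp split: split_indicator)
  qed
  also have "\<dots> = ennreal (exp (- (2 * d\<^sup>2 * real U))) * (\<integral>\<^sup>+s. W s \<partial>law t)"
    by (rule nn_integral_cmult) measurable
  also have "\<dots> \<le> ennreal (exp (- (2 * d\<^sup>2 * real U))) * 1"
    unfolding W_def by (intro mult_left_mono nn_integral_exp_deviation i) simp
  finally show ?thesis by simp
qed

text \<open>The threshold grows like the square root of the count, so the best exponent depends on
  the count. A sum over the at most \<open>t\<close> possible positive counts covers all of them and
  costs the factor \<open>t\<close>.\<close>

lemma lower_deviation:
  assumes i: "i \<in> {1..K}" and c: "c \<ge> 0"
  shows "emeasure (law t) {s. 1 \<le> fst s i \<and> fst (snd s) i < real (fst s i) * \<mu> i - sqrt (real (fst s i) * c)}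
    \<le> of_nat t * ennreal (exp (- (2 * c)))"
proof -
  let ?B = "{s. 1 \<le> fst s i \<and> fst (snd s) i < real (fst s i) * \<mu> i - sqrt (real (fst s i) * c)}"
  \<comment> \<open>Maximizes the exponent gained at count \<open>m\<close>, which becomes
    \<open>4 * c - 2 * c = 2 * c\<close>; the sign is negative because the deviation is
    downwards.\<close>
  define l where "l m = - (4 * sqrt (c / real m))" for m :: nat
  define W :: "nat \<Rightarrow> state \<Rightarrow> ennreal"
    where "W m s = ennreal (exp (l m * (fst (snd s) i - real (fst s i) * \<mu> i) - (l m)\<^sup>2 * real (fst s i) / 8))" for m s
  have [measurable]: "W m \<in> borel_measurable (law t)" for m unfolding W_def by measurable
  have "{s \<in> space (law t). s \<in> ?B} \<in> sets (law t)" unfolding mem_Collect_eq by measurable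
  hence "emeasure (law t) ?B = (\<integral>\<^sup>+s. indicator ?B s \<partial>law t)" by simp
  also have "\<dots> \<le> (\<integral>\<^sup>+s. (\<Sum>m\<in>{1..t}. ennreal (exp (- (2 * c))) * W m s) \<partial>law t)"
  proof (rule nn_integral_mono_AE[OF eventually_mono[OF AE_reachable]])
    fix s assume "reachable t s"
    hence t: "(\<Sum>i\<in>{1..K}. fst s i) = t" by (simp add: reachable_def)
    have "fst s i \<le> t" unfolding t[symmetric] using i by (intro member_le_sum) auto
    have "1 \<le> (\<Sum>m\<in>{1..t}. ennreal (exp (- (2 * c))) * W m s)" if B: "s \<in> ?B"
    proof -
      define m where "m = fst s i"
      have m: "m \<in> {1..t}" "real m > 0" using B \<open>fst s i \<le> t\<close> by (auto simp: m_def)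
      have "1 \<le> ennreal (exp (- (2 * c))) * W m s"
        unfolding W_def m_def[symmetric]
      proof (rule one_le_ennreal_exp_mult)
        have sq: "sqrt (c / real m) * sqrt (real m * c) = c"
          using m c by (simp flip: real_sqrt_mult)
        have "4 * sqrt (c / real m) * sqrt (real m * c) \<le> 4 * sqrt (c / real m) * (real m * \<mu> i - fst (snd s) i)"
          using B c by (intro mult_left_mono) (auto simp: m_def)
        moreover have "(l m)\<^sup>2 * real m / 8 = 2 * c"
          using m c by (simp add: l_def power_mult_distrib)
        ultimately show "2 * c \<le> l m * (fst (snd s) i - real m * \<mu> i) - (l m)\<^sup>2 * real m / 8"
          using sq by (simp add: l_def algebra_simps)
      qed
      also have "\<dots> \<le> (\<Sum>m\<in>{1..t}. ennreal (exp (- (2 * c))) * W m s)"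
        using m by (intro member_le_sum) auto
      finally show ?thesis .
    qed
    thus "indicator ?B s \<le> (\<Sum>m\<in>{1..t}. ennreal (exp (- (2 * c))) * W m s)"
      by (simp split: split_indicator)
  qed
  also have "\<dots> = (\<Sum>m\<in>{1..t}. ennreal (exp (- (2 * c))) * (\<integral>\<^sup>+s. W m s \<partial>law t))"
    by (simp add: nn_integral_sum nn_integral_cmult)
  also have "\<dots> \<le> (\<Sum>m\<in>{1..t}. ennreal (exp (- (2 * c))) * 1)"
    unfolding W_def by (intro sum_mono mult_left_mono nn_integral_exp_deviation i) simp
  finally show ?thesis by simp
qed

text \<open>The indicator of the event has drift at most \<open>\<delta>\<close>: without a pull of
  arm \<open>i\<close> it does not change, and after a pull the fresh index lands in
  \<open>A\<close> with probability at most \<open>\<delta>\<close> whenever the new count and sum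
  satisfy \<open>Q\<close>. The hypothesis at count 0 makes the initial value zero.\<close>

lemma bad_draws:
  assumes [measurable]: "Measurable.pred (count_space UNIV \<Otimes>\<^sub>M borel) (\<lambda>(n, S). Q n S)"
    "A \<in> sets borel" and Q0: "\<And>S. \<not> Q 0 S"
    and draw: "\<And>n S. n > 0 \<Longrightarrow> Q n S \<Longrightarrow>
      (\<integral>\<^sup>+z. indicator A (Max (z ` samples)) \<partial>sample_law S n) \<le> \<delta>"
  shows "emeasure (law t) {s. Q (fst s i) (fst (snd s) i) \<and> snd (snd s) i \<in> A} \<le> of_nat t * \<delta>"
proof -
  let ?B = "{s :: state. Q (fst s i) (fst (snd s) i) \<and> snd (snd s) i \<in> A}"
  define g :: "nat \<Rightarrow> real \<Rightarrow> real \<Rightarrow> ennreal" where "g n S \<theta> = (if Q n S then indicator A \<theta> else 0)" for n S \<theta>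
  have [measurable]: "(\<lambda>s. Q (fst s i) (fst (snd s) i)) \<in> state_space \<rightarrow>\<^sub>M count_space UNIV"
    using measurable_compose[OF measurable_Pair[OF measurable_state(1,2)[of i]] assms(1)] by simp
  have g: "(\<lambda>s. g (fst s i) (fst (snd s) i) (snd (snd s) i)) \<in> borel_measurable state_space"
    unfolding g_def by measurable
  have "{s \<in> space (law t). s \<in> ?B} \<in> sets (law t)" unfolding mem_Collect_eq by measurable
  hence "emeasure (law t) ?B = (\<integral>\<^sup>+s. indicator ?B s \<partial>law t)" by simp
  also have "\<dots> = (\<integral>\<^sup>+s. g (fst s i) (fst (snd s) i) (snd (snd s) i) \<partial>law t)"
    by (intro nn_integral_cong) (simp add: g_def indicator_def)
  also have "\<dots> \<le> g 0 0 0 + of_nat t * \<delta>"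
  proof (rule nn_integral_law_arm_growth[OF g])
    fix t n S \<theta>
    interpret \<nu>: prob_space "\<nu> t" by (rule prob_rewards)
    have "(\<integral>\<^sup>+z. g m x (Max (z ` samples)) \<partial>sample_law x m) \<le> \<delta>" if "m > 0" for m x
      using draw[OF that, of x] by (cases "Q m x") (simp_all add: g_def)
    hence "pull t g i n S \<le> (\<integral>\<^sup>+X. \<delta> \<partial>\<nu> t)"
      unfolding pull_def by (intro nn_integral_mono) simp
    also have "\<dots> = \<delta>" by (simp add: \<nu>.emeasure_space_1)
    also have "\<dots> \<le> g n S \<theta> + \<delta>" by simp
    finally show "pull t g i n S \<le> g n S \<theta> + \<delta>" .
  qed
  finally show ?thesis by (simp add: g_def Q0)
qed

end

section \<open>Calibration of the number of samples and the probability of bad draws\<close>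

lemma powr_le_affine:
  fixes L :: real
  assumes "L > 0" "0 \<le> b" "b \<le> 1"
  shows "L powr b \<le> 1 + b * (L - 1)"
  using Youngs_inequality_0[of b "1 - b" L 1] assms by (simp add: algebra_simps)

lemma powr_half_power2: "((x::real) powr (b / 2))\<^sup>2 = x powr b"
  by (simp add: power2_eq_square flip: powr_add)

context ts_ma begin

lemma num_samples_pos: "num_samples T \<alpha> > 0"
  using T ln_T_pos by (simp add: num_samples_def c0_def)

text \<open>This is what the number of samples and \<open>c0\<close> are tuned for. With
  \<open>x = L powr ((1 - \<alpha>) / 2)\<close>, the affine bound on \<open>x^2\<close> gives
  \<open>exp (- x^2 / 2) >= exp (- 1 / 2) * T powr (- (1 - \<alpha>) / 2)\<close>. The power of
  \<open>T\<close> cancels against the number of samples, and \<open>exp (- 1 / 2)\<close> and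
  \<open>sqrt (2 * pi)\<close> cancel against \<open>c0\<close>.\<close>

lemma num_samples_ge:
  "2 * L \<le> real (num_samples T \<alpha>) *
    (exp (- ((L powr ((1 - \<alpha>) / 2))\<^sup>2 / 2)) / (2 * L powr ((1 - \<alpha>) / 2) * sqrt (2 * pi)))"
proof -
  define x where "x = L powr ((1 - \<alpha>) / 2)"
  define a where "a = T powr ((1 - \<alpha>) / 2)"
  have x: "x > 0" and a: "a > 0" using ln_T_pos T by (auto simp: x_def a_def)
  have x2: "x\<^sup>2 = L powr (1 - \<alpha>)"
    by (simp add: x_def powr_half_power2)
  have "x\<^sup>2 \<le> 1 + (1 - \<alpha>) * (L - 1)"
    unfolding x2 using ln_T_pos \<alpha> by (intro powr_le_affine) auto
  also have "\<dots> \<le> 1 + (1 - \<alpha>) * L"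
    using \<alpha> by (simp add: algebra_simps)
  finally have "exp (- (1 / 2) - (1 - \<alpha>) / 2 * L) \<le> exp (- (x\<^sup>2 / 2))"
    by simp
  also have "exp (- (1 / 2) - (1 - \<alpha>) / 2 * L) = exp (- (1 / 2)) / a"
    using T by (simp add: a_def powr_def exp_diff)
  finally have e: "exp (- (1 / 2)) / a \<le> exp (- (x\<^sup>2 / 2))" .
  have Lx: "L powr ((3 - \<alpha>) / 2) = L * x"
  proof -
    have "(3 - \<alpha>) / 2 = 1 + (1 - \<alpha>) / 2" by (simp add: field_simps)
    moreover have "L powr (1 + (1 - \<alpha>) / 2) = L * x"
      unfolding powr_add x_def using ln_T_pos by simp
    ultimately show ?thesis by (simp only:)
  qed
  have sq: "sqrt (2 * exp 1 * pi) = exp (1 / 2) * sqrt (2 * pi)"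
  proof -
    have "(exp (1 / 2))\<^sup>2 = exp (1 :: real)" using exp_double[of "1 / 2 :: real"] by simp
    hence "sqrt (exp 1) = exp (1 / 2 :: real)" by (intro real_sqrt_unique) simp_all
    thus ?thesis by (simp add: real_sqrt_mult)
  qed
  have "4 * a * (L * x) * (exp (1 / 2) * sqrt (2 * pi)) \<le> real (num_samples T \<alpha>)"
    using of_nat_ceiling[of "2 * real T powr (0.5 * (1 - \<alpha>)) * L powr (0.5 * (3 - \<alpha>)) / c0"]
    unfolding num_samples_def c0_def sq by (simp add: a_def mult.assoc flip: Lx)
  hence "4 * a * (L * x) * (exp (1 / 2) * sqrt (2 * pi)) * (exp (- (1 / 2)) / a / (2 * x * sqrt (2 * pi)))
     \<le> real (num_samples T \<alpha>) * (exp (- (x\<^sup>2 / 2)) / (2 * x * sqrt (2 * pi)))"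
    using e x a by (intro mult_mono divide_right_mono) auto
  also have "4 * a * (L * x) * (exp (1 / 2) * sqrt (2 * pi)) * (exp (- (1 / 2)) / a / (2 * x * sqrt (2 * pi)))
     = 2 * L * (exp (1 / 2) * exp (- (1 / 2)))"
    using x a by (simp add: field_simps)
  also have "\<dots> = 2 * L" by (simp flip: exp_add)
  finally show ?thesis by (simp add: x_def)
qed

text \<open>A crude polynomial bound suffices: in \<open>emeasure_bad_le\<close> it is multiplied by
  a tail of order \<open>T powr (- 4)\<close>.\<close>

lemma num_samples_le:
  assumes "L \<ge> 1"
  shows "real (num_samples T \<alpha>) \<le> (2 / c0 + 1) * (real T)\<^sup>2"
proof -
  have T1: "real T \<ge> 1" using T by simp
  have c0: "c0 > 0" by (simp add: c0_def)
  have "L powr (0.5 * (3 - \<alpha>)) \<le> L powr (3 / 2)"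
    using assms \<alpha> by (intro powr_mono) auto
  also have "\<dots> \<le> real T powr (3 / 2)"
    using ln_T_pos ln_bound[of "real T"] T by (intro powr_mono2) auto
  finally have "real T powr (0.5 * (1 - \<alpha>)) * L powr (0.5 * (3 - \<alpha>)) \<le> real T powr (1 / 2) * real T powr (3 / 2)"
    using \<alpha> T1 by (intro mult_mono powr_mono) auto
  also have "\<dots> = (real T)\<^sup>2"
    using T1 by (simp add: powr_add[symmetric] powr_numeral)
  finally have "2 * real T powr (0.5 * (1 - \<alpha>)) * L powr (0.5 * (3 - \<alpha>)) / c0 \<le> 2 / c0 * (real T)\<^sup>2"
    using c0 by (simp add: field_simps)
  moreover have "real (nat \<lceil>y\<rceil>) \<le> y + 1" if "y \<ge> 0" for y
    using that of_int_ceiling_le_add_one[of y] by simp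
  hence "real (num_samples T \<alpha>) \<le> 2 * real T powr (0.5 * (1 - \<alpha>)) * L powr (0.5 * (3 - \<alpha>)) / c0 + 1"
    unfolding num_samples_def using c0 by simp
  moreover have "1 \<le> (real T)\<^sup>2" using T1 by simp
  ultimately show ?thesis by (simp add: distrib_right)
qed

lemma exp_minus_two_L: "exp (- (2 * L)) = 1 / (real T)\<^sup>2"
proof -
  have "exp (2 * L) = (exp L)\<^sup>2" by (simp flip: exp_double)
  thus ?thesis using T by (simp add: exp_minus inverse_eq_divide)
qed

text \<open>With \<open>x = L powr ((1 - \<alpha>) / 2)\<close> and variance
  \<open>L powr \<alpha> / n\<close>, \<open>x\<close> standard deviations equal
  \<open>sqrt (L / n)\<close>, so \<open>\<mu> i\<close> is at most that far above the empirical
  mean. The lower tail at \<open>x\<close> and \<open>num_samples_ge\<close> then apply;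
  \<open>L \<ge> 1\<close> ensures \<open>x \<ge> 1\<close>.\<close>

lemma optimal_arm_bad_draws:
  assumes "L \<ge> 1" and i: "i \<in> {1..K}"
  shows "emeasure (law t) {s. (1 \<le> fst s i \<and> real (fst s i) * \<mu> i - sqrt (real (fst s i) * L) \<le> fst (snd s) i)
      \<and> snd (snd s) i \<in> {..<\<mu> i}} \<le> of_nat t * ennreal (1 / (real T)\<^sup>2)"
proof (rule bad_draws)
  fix n S assume n: "n > 0" "1 \<le> n \<and> real n * \<mu> i - sqrt (real n * L) \<le> S"
  define x where "x = L powr ((1 - \<alpha>) / 2)"
  define v where "v = L powr \<alpha> / real n"
  have v: "v > 0" using ln_T_pos n by (simp add: v_def)
  have x: "x \<ge> 1" unfolding x_def using assms \<alpha> by (intro ge_one_powr_ge_zero) auto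
  have "x\<^sup>2 * v = L / real n"
    using ln_T_pos by (simp add: x_def v_def powr_half_power2 flip: powr_add)
  hence vx: "sqrt v * x = sqrt (L / real n)"
    using x v by (metis mult.commute real_sqrt_mult real_sqrt_unique zero_le_one order_trans)
  have "sqrt (real n * L) / real n = sqrt (L / real n)"
    using n(1) ln_T_pos by (simp add: real_sqrt_mult real_sqrt_divide real_div_sqrt field_simps)
  moreover have "(real n * \<mu> i - sqrt (real n * L)) / real n \<le> S / real n"
    using n by (intro divide_right_mono) auto
  ultimately have le: "\<mu> i \<le> S / real n + sqrt v * x"
    using n(1) vx by (simp add: diff_divide_distrib)
  have "(\<integral>\<^sup>+z. indicator {..<\<mu> i} (Max (z ` samples)) \<partial>sample_law S n) \<le>
     ennreal (exp (- (real (card samples) * (exp (- (x\<^sup>2 / 2)) / (2 * x * sqrt (2 * pi))))))"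
    unfolding sample_law_def v_def[symmetric]
  proof (rule nn_integral_Max_gaussian_less[OF v])
    have "ennreal (exp (- (x\<^sup>2 / 2)) / (2 * x * sqrt (2 * pi))) \<le> emeasure (gaussian (S / real n) v) {S / real n + sqrt v * x..}"
      by (rule gaussian_lower_tail[OF v x])
    also have "\<dots> \<le> emeasure (gaussian (S / real n) v) {\<mu> i..}"
      using le by (intro emeasure_mono) auto
    finally show "ennreal (exp (- (x\<^sup>2 / 2)) / (2 * x * sqrt (2 * pi))) \<le> emeasure (gaussian (S / real n) v) {\<mu> i..}" .
  qed (use x num_samples_pos in auto)
  also have "\<dots> \<le> ennreal (exp (- (2 * L)))"
    using num_samples_ge by (intro ennreal_leI) (simp add: x_def)
  finally show "(\<integral>\<^sup>+z. indicator {..<\<mu> i} (Max (z ` samples)) \<partial>sample_law S n) \<le> ennreal (1 / (real T)\<^sup>2)"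
    by (simp add: exp_minus_two_L)
qed simp_all

text \<open>Some sample must exceed its mean by \<open>d\<close>, that is by
  \<open>d / sqrt v\<close> standard deviations for the variance
  \<open>v = L powr \<alpha> / n\<close>. This is rarer the larger \<open>n\<close> is, so
  \<open>n = U\<close> is the worst case in the union bound.\<close>

lemma suboptimal_arm_bad_draws:
  assumes d: "d > 0" and U: "U \<ge> 1"
  shows "emeasure (law t) {s. (U \<le> fst s i \<and> fst (snd s) i \<le> real (fst s i) * (m + d))
      \<and> snd (snd s) i \<in> {m + 2 * d..}}
     \<le> of_nat t * ennreal (real (num_samples T \<alpha>) * exp (- (d\<^sup>2 * real U / (2 * L powr \<alpha>))))"
proof (rule bad_draws)
  fix n S assume n: "n > 0" "U \<le> n \<and> S \<le> real n * (m + d)"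
  define v where "v = L powr \<alpha> / real n"
  define x where "x = d / sqrt v"
  have v: "v > 0" using ln_T_pos n by (simp add: v_def)
  have x: "x \<ge> 0" using d v by (simp add: x_def)
  have vx: "sqrt v * x = d" using v by (simp add: x_def)
  have "S / real n \<le> m + d" using n by (simp add: divide_le_eq mult.commute)
  hence le: "S / real n + sqrt v * x \<le> m + 2 * d" by (simp add: vx)
  have "(\<integral>\<^sup>+z. indicator {m + 2 * d..} (Max (z ` samples)) \<partial>sample_law S n) \<le>
     (\<integral>\<^sup>+z. indicator {S / real n + sqrt v * x..} (Max (z ` samples)) \<partial>sample_law S n)"
    using le by (intro nn_integral_mono) (auto simp: indicator_def)
  also have "\<dots> \<le> ennreal (real (card samples) * exp (- (x\<^sup>2 / 2)))"
    unfolding sample_law_def v_def[symmetric]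
    using num_samples_pos by (intro nn_integral_Max_gaussian_ge v x) auto
  also have "\<dots> \<le> ennreal (real (num_samples T \<alpha>) * exp (- (d\<^sup>2 * real U / (2 * L powr \<alpha>))))"
  proof -
    have "x\<^sup>2 / 2 = d\<^sup>2 * real n / (2 * L powr \<alpha>)"
      using v by (simp add: x_def power_divide v_def)
    also have "\<dots> \<ge> d\<^sup>2 * real U / (2 * L powr \<alpha>)"
      using n by (intro divide_right_mono mult_left_mono) auto
    finally show ?thesis
      by (intro ennreal_leI mult_mono) auto
  qed
  finally show "(\<integral>\<^sup>+z. indicator {m + 2 * d..} (Max (z ` samples)) \<partial>sample_law S n)
     \<le> ennreal (real (num_samples T \<alpha>) * exp (- (d\<^sup>2 * real U / (2 * L powr \<alpha>))))" .
qed (use U in simp_all)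

end

section \<open>Expected numbers of pulls and regret\<close>

context ts_ma begin

lemma gap_pos: "i \<in> {1..K} \<Longrightarrow> i \<noteq> 1 \<Longrightarrow> gap p i > 0"
  using unique_optimal by (simp add: gap_def)

lemma one_arm: "1 \<in> {1..K}"
  using two_arms by simp

lemma integrable_arm: "i \<in> {1..K} \<Longrightarrow> integrable (p i) (\<lambda>x. x)"
  and arm_mean_bounds: "i \<in> {1..K} \<Longrightarrow> \<mu> i \<in> {0..1}"
proof -
  assume i: "i \<in> {1..K}"
  interpret prob_space "p i" by (rule prob_arm[OF i])
  have [measurable_cong]: "sets (p i) = sets borel" by (rule sets_arm[OF i])
  show int: "integrable (p i) (\<lambda>x. x)"
    by (rule integrable_const_bound[where B = 1]) (use AE_arm[OF i] in \<open>auto elim: eventually_mono\<close>)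
  have "\<mu> i \<ge> 0"
    unfolding arm_mean_def by (rule integral_nonneg_AE) (use AE_arm[OF i] in auto)
  moreover have "\<mu> i \<le> 1"
    unfolding arm_mean_def by (rule integral_le_const[OF int]) (use AE_arm[OF i] in auto)
  ultimately show "\<mu> i \<in> {0..1}" by simp
qed

lemma gap_le_one: "i \<in> {1..K} \<Longrightarrow> gap p i \<le> 1"
  using arm_mean_bounds[of i] arm_mean_bounds[OF one_arm] by (simp add: gap_def)

text \<open>The states from which arm \<open>i\<close> may be chosen although it has at least
  \<open>U\<close> pulls: if its index is at least that of arm 1, one of the two lies on the wrong
  side of \<open>\<mu> 1\<close>. The count of arm 1 is required positive so that the initial dummy
  index is excluded.\<close>

definition bad :: "nat \<Rightarrow> nat \<Rightarrow> state set" where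
  "bad U i = {s. 1 \<le> fst s 1 \<and> snd (snd s) 1 < \<mu> 1} \<union> {s. U \<le> fst s i \<and> \<mu> 1 \<le> snd (snd s) i}"

lemma sets_bad [measurable]: "bad U i \<in> sets (law t)"
proof -
  have "{s \<in> space (law t). (1 \<le> fst s 1 \<and> snd (snd s) 1 < \<mu> 1) \<or> (U \<le> fst s i \<and> \<mu> 1 \<le> snd (snd s) i)} \<in> sets (law t)"
    by measurable
  thus ?thesis by (simp add: bad_def Un_def)
qed

text \<open>Each of the two bad conditions is split according to whether the empirical mean is off
  (\<open>B1\<close>, \<open>Bi\<close>) or is good but the draw is off (\<open>G1\<close>,
  \<open>Gi\<close>). Three of the pieces cost \<open>1 / T\<close> each, and \<open>Gi\<close>
  costs \<open>(2 / c0 + 1) / T\<close>.\<close>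

lemma emeasure_bad_le:
  assumes L1: "L \<ge> 1" and i: "i \<in> {1..K}" "i \<noteq> 1" and t: "t \<le> T"
    and U: "32 * L powr (\<alpha> + 1) / (gap p i)\<^sup>2 \<le> real U" "U \<ge> 1"
  shows "emeasure (law t) (bad U i) \<le> ennreal ((4 + 2 / c0) / real T)"
proof -
  \<comment> \<open>Half of the gap is granted to the empirical mean of arm \<open>i\<close> and
    half to the draw.\<close>
  define d where "d = gap p i / 2"
  have "2 * d = gap p i" by (simp add: d_def)
  hence d: "d > 0" "\<mu> i + 2 * d = \<mu> 1" using gap_pos[OF i] by (auto simp: gap_def)
  have T0: "real T > 0" using T by simp
  have c0: "c0 > 0" by (simp add: c0_def)
  \<comment> \<open>Since \<open>d^2\<close> is a quarter of the squared gap, the constant 32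
    becomes 8, which yields the exponent \<open>4 * L\<close> for \<open>Gi\<close>.\<close>
  have Ld: "8 * L powr (\<alpha> + 1) \<le> d\<^sup>2 * real U"
    using U(1) gap_pos[OF i] by (simp add: d_def field_simps power2_eq_square)
  have tT: "real t / (real T)\<^sup>2 \<le> 1 / real T"
    using t T0 by (simp add: power2_eq_square divide_simps)
  define B1 where "B1 = {s :: state. 1 \<le> fst s 1 \<and> fst (snd s) 1 < real (fst s 1) * \<mu> 1 - sqrt (real (fst s 1) * L)}"
  define G1 where "G1 = {s :: state. (1 \<le> fst s 1 \<and> real (fst s 1) * \<mu> 1 - sqrt (real (fst s 1) * L) \<le> fst (snd s) 1)
      \<and> snd (snd s) 1 \<in> {..<\<mu> 1}}"
  define Bi where "Bi = {s :: state. U \<le> fst s i \<and> real (fst s i) * (\<mu> i + d) < fst (snd s) i}"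
  define Gi where "Gi = {s :: state. (U \<le> fst s i \<and> fst (snd s) i \<le> real (fst s i) * (\<mu> i + d))
      \<and> snd (snd s) i \<in> {\<mu> i + 2 * d..}}"
  have "{s \<in> space (law t). 1 \<le> fst s 1 \<and> fst (snd s) 1 < real (fst s 1) * \<mu> 1 - sqrt (real (fst s 1) * L)} \<in> sets (law t)"
    by measurable
  hence [measurable]: "B1 \<in> sets (law t)" by (simp add: B1_def)
  have "{s \<in> space (law t). (1 \<le> fst s 1 \<and> real (fst s 1) * \<mu> 1 - sqrt (real (fst s 1) * L) \<le> fst (snd s) 1)
      \<and> snd (snd s) 1 \<in> {..<\<mu> 1}} \<in> sets (law t)"
    by measurable
  hence [measurable]: "G1 \<in> sets (law t)" by (simp add: G1_def)
  have "{s \<in> space (law t). U \<le> fst s i \<and> real (fst s i) * (\<mu> i + d) < fst (snd s) i} \<in> sets (law t)"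
    by measurable
  hence [measurable]: "Bi \<in> sets (law t)" by (simp add: Bi_def)
  have "{s \<in> space (law t). (U \<le> fst s i \<and> fst (snd s) i \<le> real (fst s i) * (\<mu> i + d))
      \<and> snd (snd s) i \<in> {\<mu> i + 2 * d..}} \<in> sets (law t)"
    by measurable
  hence [measurable]: "Gi \<in> sets (law t)" by (simp add: Gi_def)

  have "emeasure (law t) B1 \<le> of_nat t * ennreal (exp (- (2 * L)))"
    unfolding B1_def using lower_deviation[OF one_arm] ln_T_pos by simp
  also have "\<dots> = ennreal (real t / (real T)\<^sup>2)"
    by (simp add: exp_minus_two_L ennreal_of_nat_eq_real_of_nat flip: ennreal_mult)
  finally have B1: "emeasure (law t) B1 \<le> ennreal (1 / real T)"
    using tT by (meson ennreal_leI order_trans)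

  have "emeasure (law t) G1 \<le> of_nat t * ennreal (1 / (real T)\<^sup>2)"
    unfolding G1_def by (rule optimal_arm_bad_draws[OF L1 one_arm])
  also have "\<dots> = ennreal (real t / (real T)\<^sup>2)"
    by (simp add: ennreal_of_nat_eq_real_of_nat flip: ennreal_mult)
  finally have G1: "emeasure (law t) G1 \<le> ennreal (1 / real T)"
    using tT by (meson ennreal_leI order_trans)

  have "emeasure (law t) Bi \<le> ennreal (exp (- (2 * d\<^sup>2 * real U)))"
    unfolding Bi_def by (rule upper_deviation[OF i(1) d(1)])
  also have "\<dots> \<le> ennreal (1 / real T)"
  proof (rule ennreal_leI)
    have "L powr 1 \<le> L powr (\<alpha> + 1)"
      using L1 \<alpha> by (intro powr_mono) auto
    hence "L \<le> 2 * d\<^sup>2 * real U" using Ld ln_T_pos by simp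
    hence "exp (- (2 * d\<^sup>2 * real U)) \<le> exp (- L)" by simp
    also have "\<dots> = 1 / real T" using T by (simp add: exp_minus inverse_eq_divide)
    finally show "exp (- (2 * d\<^sup>2 * real U)) \<le> 1 / real T" .
  qed
  finally have Bi: "emeasure (law t) Bi \<le> ennreal (1 / real T)" .

  have "emeasure (law t) Gi \<le> of_nat t * ennreal (real (num_samples T \<alpha>) * exp (- (d\<^sup>2 * real U / (2 * L powr \<alpha>))))"
    unfolding Gi_def by (rule suboptimal_arm_bad_draws[OF d(1) U(2)])
  also have "\<dots> = ennreal (real t * (real (num_samples T \<alpha>) * exp (- (d\<^sup>2 * real U / (2 * L powr \<alpha>)))))"
    by (simp add: ennreal_of_nat_eq_real_of_nat flip: ennreal_mult)
  also have "\<dots> \<le> ennreal ((2 / c0 + 1) / real T)"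
  proof (rule ennreal_leI)
    \<comment> \<open>The tail \<open>exp (- 4 * L) = T powr (- 4)\<close> pays for the factor
      \<open>t \<le> T\<close>, for the number of samples of order \<open>T^2\<close>, and leaves
      \<open>1 / T\<close>.\<close>
    have "4 * L = 8 * L powr (\<alpha> + 1) / (2 * L powr \<alpha>)"
      using ln_T_pos by (simp add: powr_add)
    also have "\<dots> \<le> d\<^sup>2 * real U / (2 * L powr \<alpha>)"
      by (intro divide_right_mono Ld) simp
    finally have "exp (- (d\<^sup>2 * real U / (2 * L powr \<alpha>))) \<le> exp (- (2 * L) + - (2 * L))" by simp
    also have "\<dots> = 1 / ((real T)\<^sup>2 * (real T)\<^sup>2)" unfolding exp_add exp_minus_two_L by simp
    finally have "real t * (real (num_samples T \<alpha>) * exp (- (d\<^sup>2 * real U / (2 * L powr \<alpha>)))) \<le>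
       real T * ((2 / c0 + 1) * (real T)\<^sup>2 * (1 / ((real T)\<^sup>2 * (real T)\<^sup>2)))"
      using t num_samples_le[OF L1] by (intro mult_mono) auto
    also have "\<dots> = (2 / c0 + 1) / real T"
      using T0 by (simp add: power2_eq_square)
    finally show "real t * (real (num_samples T \<alpha>) * exp (- (d\<^sup>2 * real U / (2 * L powr \<alpha>)))) \<le> (2 / c0 + 1) / real T" .
  qed
  finally have Gi: "emeasure (law t) Gi \<le> ennreal ((2 / c0 + 1) / real T)" .

  have "bad U i \<subseteq> (B1 \<union> G1) \<union> (Bi \<union> Gi)"
    using d(2) by (auto simp: bad_def B1_def G1_def Bi_def Gi_def)
  hence "emeasure (law t) (bad U i) \<le> emeasure (law t) ((B1 \<union> G1) \<union> (Bi \<union> Gi))"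
    by (intro emeasure_mono) measurable
  also have "\<dots> \<le> emeasure (law t) (B1 \<union> G1) + emeasure (law t) (Bi \<union> Gi)"
    by (intro emeasure_subadditive) measurable
  also have "\<dots> \<le> (emeasure (law t) B1 + emeasure (law t) G1) + (emeasure (law t) Bi + emeasure (law t) Gi)"
    by (intro add_mono emeasure_subadditive) measurable
  also have "\<dots> \<le> (ennreal (1 / real T) + ennreal (1 / real T)) + (ennreal (1 / real T) + ennreal ((2 / c0 + 1) / real T))"
    by (intro add_mono B1 G1 Bi Gi)
  also have "\<dots> = ennreal ((4 + 2 / c0) / real T)"
    using T0 c0 by (simp flip: ennreal_plus add: add_divide_distrib)
  finally show ?thesis .
qed

text \<open>Capping the count from below by \<open>U\<close> makes the first \<open>U\<close> pulls
  free. Beyond that, the count grows only in the initialization round of arm \<open>i\<close> or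
  from a bad state.\<close>

lemma nn_integral_step_max_pulls:
  assumes i: "i \<in> {1..K}" and U: "U \<ge> 1" and s: "reachable t s"
  shows "(\<integral>\<^sup>+s'. ennreal (real (max (fst s' i) U)) \<partial>ts_ma_step K \<nu> tie T \<alpha> (Suc t) s)
    \<le> ennreal (real (max (fst s i) U)) + (of_bool (Suc t = i) + indicator (bad U i) s)"
proof -
  obtain n S \<theta> where s': "s = (n, S, \<theta>)" by (cases s)
  interpret \<nu>: prob_space "\<nu> (Suc t)" by (rule prob_rewards)
  define g where "g n = ennreal (real (max n U))" for n
  have g: "(\<lambda>s. g (fst s i)) \<in> borel_measurable state_space"
    unfolding g_def by measurable
  have pull: "pull (Suc t) (\<lambda>n _ _. g n) i (n i) (S i) = g (n i + 1)"
    by (simp add: pull_def emeasure_space_sample_law \<nu>.emeasure_space_1)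
  have "(\<integral>\<^sup>+s'. g (fst s' i) \<partial>ts_ma_step K \<nu> tie T \<alpha> (Suc t) s)
      = (\<integral>\<^sup>+j. (if j = i then g (n i + 1) else g (n i)) \<partial>choose_arm K tie (Suc t) \<theta>)"
    unfolding s' by (subst nn_integral_step_arm[of "\<lambda>n _ _. g n", OF g]) (simp only: pull)
  also have "\<dots> \<le> (\<integral>\<^sup>+j. g (n i) + (of_bool (Suc t = i) + indicator (bad U i) s) \<partial>choose_arm K tie (Suc t) \<theta>)"
  proof (rule nn_integral_mono_AE)
    have le: "g (n i + 1) \<le> g (n i) + 1"
    proof -
      have "g (n i + 1) \<le> ennreal (real (max (n i) U) + 1)"
        unfolding g_def by (intro ennreal_leI) auto
      thus ?thesis by (simp add: g_def)
    qed
    have ok: "g (n i + 1) \<le> g (n i) + (of_bool (Suc t = i) + indicator (bad U i) s)"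
      if "n i < U \<or> Suc t = i \<or> s \<in> bad U i"
    proof (cases "n i < U")
      case True
      hence "g (n i + 1) = g (n i)" by (simp add: g_def max_def)
      thus ?thesis by simp
    next
      case False
      hence "1 \<le> (of_bool (Suc t = i) + indicator (bad U i) s :: ennreal)"
        using that by (auto simp: add_increasing)
      thus ?thesis using le by (meson add_left_mono order_trans)
    qed
    show "AE j in measure_pmf (choose_arm K tie (Suc t) \<theta>). (if j = i then g (n i + 1) else g (n i))
       \<le> g (n i) + (of_bool (Suc t = i) + indicator (bad U i) s)"
    proof (cases "Suc t \<le> K")
      case le_K: True
      show ?thesis
      proof (cases "Suc t = i")
        case True
        with ok have "g (n i + 1) \<le> g (n i) + (of_bool (Suc t = i) + indicator (bad U i) s)" by blast
        thus ?thesis using le_K by (auto simp: choose_arm_def AE_measure_pmf_iff)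
      next
        case False
        thus ?thesis using le_K by (simp add: choose_arm_def AE_measure_pmf_iff)
      qed
    next
      case False
      hence "t \<ge> 1" using two_arms by simp
      hence n1: "1 \<le> n 1" using s by (simp add: reachable_def s')
      have "AE j in measure_pmf (choose_arm K tie (Suc t) \<theta>). j \<in> argmax_arms K \<theta>"
        using False by (intro AE_choose_arm_max) simp
      thus ?thesis
      proof (rule eventually_mono)
        \<comment> \<open>If \<open>i\<close> is a maximizer, then
          \<open>\<theta> 1 \<le> \<theta> i\<close>; comparing both with \<open>\<mu> 1\<close>
          shows that the state is bad unless \<open>n i < U\<close>.\<close>
        fix j assume j: "j \<in> argmax_arms K \<theta>"
        have "n i < U \<or> s \<in> bad U i" if "j = i"
        proof -
          have "\<theta> 1 \<le> \<theta> i"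
            using j that one_arm by (auto simp: argmax_arms_def is_arg_max_def not_less)
          thus ?thesis using n1 by (auto simp: bad_def s')
        qed
        thus "(if j = i then g (n i + 1) else g (n i)) \<le> g (n i) + (of_bool (Suc t = i) + indicator (bad U i) s)"
          using ok by auto
      qed
    qed
  qed
  finally show ?thesis by (simp add: g_def s')
qed

text \<open>Summation of the one-step bound. In the induction, \<open>of_bool (i \<le> t)\<close>
  records whether the initialization pull has happened, so that it is charged once and not in every
  round.\<close>

lemma nn_integral_pulls_le:
  assumes i: "i \<in> {1..K}" and U: "U \<ge> 1" and e: "e \<ge> 0"
    and bad: "\<And>t. t \<le> T \<Longrightarrow> emeasure (law t) (bad U i) \<le> ennreal e"
  shows "(\<integral>\<^sup>+s. ennreal (real (fst s i)) \<partial>law T) \<le> ennreal (real U + 1 + real T * e)"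
proof -
  have "(\<integral>\<^sup>+s. ennreal (real (max (fst s i) U)) \<partial>law t) \<le> ennreal (real U + of_bool (i \<le> t) + real t * e)"
    if "t \<le> T" for t
    using that
  proof (induction t)
    case 0
    show ?case using i by (subst nn_integral_law_0) auto
  next
    case (Suc t)
    interpret prob_space "law t" by (rule prob_law)
    have "(\<integral>\<^sup>+s. ennreal (real (max (fst s i) U)) \<partial>law (Suc t)) =
      (\<integral>\<^sup>+s. \<integral>\<^sup>+s'. ennreal (real (max (fst s' i) U)) \<partial>ts_ma_step K \<nu> tie T \<alpha> (Suc t) s \<partial>law t)"
      by (rule nn_integral_law_Suc) measurable
    also have "\<dots> \<le> (\<integral>\<^sup>+s. ennreal (real (max (fst s i) U)) + (of_bool (Suc t = i) + indicator (bad U i) s) \<partial>law t)"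
      by (rule nn_integral_mono_AE[OF eventually_mono[OF AE_reachable]]) (rule nn_integral_step_max_pulls[OF i U])
    also have "\<dots> = (\<integral>\<^sup>+s. ennreal (real (max (fst s i) U)) \<partial>law t) + (of_bool (Suc t = i) + emeasure (law t) (bad U i))"
      using emeasure_space_1 by (simp add: nn_integral_add)
    also have "\<dots> \<le> ennreal (real U + of_bool (i \<le> t) + real t * e) + (ennreal (of_bool (Suc t = i)) + ennreal e)"
      using Suc by (intro add_mono bad) auto
    also have "\<dots> = ennreal (real U + of_bool (i \<le> Suc t) + real (Suc t) * e)"
      using e by (simp flip: ennreal_plus add: algebra_simps)
    finally show ?case .
  qed
  from this[of T] have "(\<integral>\<^sup>+s. ennreal (real (max (fst s i) U)) \<partial>law T) \<le> ennreal (real U + of_bool (i \<le> T) + real T * e)"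
    by simp
  moreover have "(\<integral>\<^sup>+s. ennreal (real (fst s i)) \<partial>law T) \<le> (\<integral>\<^sup>+s. ennreal (real (max (fst s i) U)) \<partial>law T)"
    by (intro nn_integral_mono ennreal_leI) auto
  moreover have "ennreal (real U + of_bool (i \<le> T) + real T * e) \<le> ennreal (real U + 1 + real T * e)"
    by (intro ennreal_leI) auto
  ultimately show ?thesis by (meson order_trans)
qed

text \<open>Wald's identity: a reward is independent of the decision to collect it.\<close>

lemma nn_integral_rewards_eq:
  assumes i: "i \<in> {1..K}"
  shows "(\<integral>\<^sup>+s. ennreal (fst (snd s) i) \<partial>law t) = ennreal (\<mu> i) * (\<integral>\<^sup>+s. ennreal (real (fst s i)) \<partial>law t)"
proof (induction t)
  case 0
  show ?case by (simp add: nn_integral_return)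
next
  case (Suc t)
  interpret \<nu>: prob_space "\<nu> (Suc t)" by (rule prob_rewards)
  have [measurable_cong]: "sets (p i) = sets borel" by (rule sets_arm[OF i])
  interpret p: prob_space "p i" by (rule prob_arm[OF i])
  \<comment> \<open>The chance that arm \<open>i\<close> is chosen given the indices. One round adds
    \<open>P\<close> to the expected count and \<open>\<mu> i * P\<close> to the expected reward
    sum, so the two stay proportional.\<close>
  define P where "P \<theta> = emeasure (measure_pmf (choose_arm K tie (Suc t) \<theta>)) {i}" for \<theta>
  have [measurable]: "(\<lambda>s. P (snd (snd s))) \<in> borel_measurable (law t)"
  proof -
    have "(\<lambda>s. measure_pmf (choose_arm K tie (Suc t) (snd (snd s)))) \<in> state_space \<rightarrow>\<^sub>M subprob_algebra (count_space UNIV)"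
      by (rule measurable_prob_algebraD, rule measurable_compose[OF _ measurable_choose_arm]) (simp add: state_space_def)
    hence "(\<lambda>s. P (snd (snd s))) \<in> borel_measurable state_space"
      unfolding P_def by (rule measurable_compose[OF _ measurable_emeasure_subprob_algebra]) simp
    thus ?thesis by measurable
  qed
  have choose: "(\<integral>\<^sup>+j. (if j = i then a + b else a) \<partial>choose_arm K tie (Suc t) \<theta>) = a + b * P \<theta>" for a b \<theta>
  proof -
    have "(\<integral>\<^sup>+j. (if j = i then a + b else a) \<partial>choose_arm K tie (Suc t) \<theta>) =
        (\<integral>\<^sup>+j. a + b * indicator {i} j \<partial>choose_arm K tie (Suc t) \<theta>)"
      by (intro nn_integral_cong) (auto simp: indicator_def)
    thus ?thesis by (simp add: nn_integral_add nn_integral_cmult P_def)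
  qed
  have mean: "(\<integral>\<^sup>+x. ennreal x \<partial>p i) = ennreal (\<mu> i)"
    unfolding arm_mean_def using AE_arm[OF i]
    by (intro nn_integral_eq_integral integrable_arm i) (auto elim: eventually_mono)
  have stepS: "(\<integral>\<^sup>+s'. ennreal (fst (snd s') i) \<partial>ts_ma_step K \<nu> tie T \<alpha> (Suc t) s) = ennreal (fst (snd s) i) + ennreal (\<mu> i) * P (snd (snd s))"
    if "reachable t s" for s
  proof -
    obtain n S \<theta> where s: "s = (n, S, \<theta>)" by (cases s)
    have S: "S i \<ge> 0" using that i by (simp add: reachable_def s)
    have "(\<integral>\<^sup>+X. ennreal (S i + X i) \<partial>\<nu> (Suc t)) = (\<integral>\<^sup>+x. ennreal (S i + x) \<partial>p i)"
      by (rule nn_integral_reward[OF i]) measurable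
    also have "\<dots> = (\<integral>\<^sup>+x. ennreal (S i) + ennreal x \<partial>p i)"
      by (rule nn_integral_cong_AE[OF eventually_mono[OF AE_arm[OF i]]]) (use S in auto)
    also have "\<dots> = ennreal (S i) + ennreal (\<mu> i)"
      by (simp add: nn_integral_add mean p.emeasure_space_1)
    finally have "pull (Suc t) (\<lambda>n S _. ennreal S) i (n i) (S i) = ennreal (S i) + ennreal (\<mu> i)"
      by (simp add: pull_sample_free[of _ "\<lambda>n S. ennreal S"])
    thus ?thesis
      unfolding s using nn_integral_step_arm[of "\<lambda>n S _. ennreal S" i "Suc t" n S \<theta>]
      by (simp add: choose cong: if_cong)
  qed
  have stepn: "(\<integral>\<^sup>+s'. ennreal (real (fst s' i)) \<partial>ts_ma_step K \<nu> tie T \<alpha> (Suc t) s) = ennreal (real (fst s i)) + 1 * P (snd (snd s))" for s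
  proof -
    obtain n S \<theta> where s: "s = (n, S, \<theta>)" by (cases s)
    have "pull (Suc t) (\<lambda>n S _. ennreal (real n)) i (n i) (S i) = ennreal (real (n i)) + 1"
      by (simp add: pull_sample_free[of _ "\<lambda>n S. ennreal (real n)"] \<nu>.emeasure_space_1 add.commute)
    thus ?thesis
      unfolding s using nn_integral_step_arm[of "\<lambda>n S _. ennreal (real n)" i "Suc t" n S \<theta>]
      by (simp add: choose cong: if_cong)
  qed
  have "(\<integral>\<^sup>+s. ennreal (fst (snd s) i) \<partial>law (Suc t)) = (\<integral>\<^sup>+s. ennreal (fst (snd s) i) + ennreal (\<mu> i) * P (snd (snd s)) \<partial>law t)"
    by (subst nn_integral_law_Suc, measurable)
       (rule nn_integral_cong_AE[OF eventually_mono[OF AE_reachable]], rule stepS)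
  also have "\<dots> = ennreal (\<mu> i) * ((\<integral>\<^sup>+s. ennreal (real (fst s i)) \<partial>law t) + (\<integral>\<^sup>+s. P (snd (snd s)) \<partial>law t))"
    by (simp add: nn_integral_add nn_integral_cmult Suc distrib_left)
  also have "(\<integral>\<^sup>+s. ennreal (real (fst s i)) \<partial>law t) + (\<integral>\<^sup>+s. P (snd (snd s)) \<partial>law t) = (\<integral>\<^sup>+s. ennreal (real (fst s i)) \<partial>law (Suc t))"
    by (subst nn_integral_law_Suc, measurable) (simp add: stepn nn_integral_add)
  finally show ?case .
qed

section \<open>From expected pull counts to the regret bounds\<close>

definition pulls :: "nat \<Rightarrow> real" where
  "pulls i = (\<integral>s. real (fst s i) \<partial>law T)"

lemma reachable_pulls_le: "reachable t s \<Longrightarrow> i \<in> {1..K} \<Longrightarrow> fst s i \<le> t"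
proof -
  assume "reachable t s" "i \<in> {1..K}"
  hence "fst s i \<le> (\<Sum>i\<in>{1..K}. fst s i)" by (intro member_le_sum) auto
  thus ?thesis using \<open>reachable t s\<close> by (simp add: reachable_def)
qed

lemma integrable_pulls: "i \<in> {1..K} \<Longrightarrow> integrable (law T) (\<lambda>s. real (fst s i))"
  and integrable_rewards: "i \<in> {1..K} \<Longrightarrow> integrable (law T) (\<lambda>s. fst (snd s) i)"
proof -
  assume i: "i \<in> {1..K}"
  interpret prob_space "law T" by (rule prob_law)
  show "integrable (law T) (\<lambda>s. real (fst s i))"
  proof (rule integrable_const_bound)
    show "AE s in law T. norm (real (fst s i)) \<le> real T"
      using AE_reachable by (rule eventually_mono) (use reachable_pulls_le i in auto)
  qed measurable
  show "integrable (law T) (\<lambda>s. fst (snd s) i)"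
  proof (rule integrable_const_bound)
    show "AE s in law T. norm (fst (snd s) i) \<le> real T"
      using AE_reachable
    proof (rule eventually_mono)
      fix s assume s: "reachable T s"
      have "0 \<le> fst (snd s) i \<and> fst (snd s) i \<le> real (fst s i)"
        using s i unfolding reachable_def by blast
      thus "norm (fst (snd s) i) \<le> real T"
        using reachable_pulls_le[OF s i] by simp
    qed
  qed measurable
qed

lemma nn_integral_pulls: "i \<in> {1..K} \<Longrightarrow> (\<integral>\<^sup>+s. ennreal (real (fst s i)) \<partial>law T) = ennreal (pulls i)"
  unfolding pulls_def by (intro nn_integral_eq_integral integrable_pulls) auto

lemma pulls_nonneg: "pulls i \<ge> 0"
  unfolding pulls_def by (intro Bochner_Integration.integral_nonneg) simp

lemma sum_pulls: "(\<Sum>i\<in>{1..K}. pulls i) = real T"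
proof -
  interpret prob_space "law T" by (rule prob_law)
  have "(\<Sum>i\<in>{1..K}. pulls i) = (\<integral>s. (\<Sum>i\<in>{1..K}. real (fst s i)) \<partial>law T)"
    unfolding pulls_def by (intro Bochner_Integration.integral_sum[symmetric] integrable_pulls)
  also have "\<dots> = (\<integral>s. real T \<partial>law T)"
  proof (intro integral_cong_AE)
    show "AE s in law T. (\<Sum>i\<in>{1..K}. real (fst s i)) = real T"
      using AE_reachable by (rule eventually_mono) (simp add: reachable_def flip: of_nat_sum)
  qed measurable
  also have "\<dots> = real T" using prob_space by simp
  finally show ?thesis .
qed

lemma pulls_le_T: "i \<in> {1..K} \<Longrightarrow> pulls i \<le> real T"
  unfolding sum_pulls[symmetric] by (intro member_le_sum pulls_nonneg) auto

lemma integral_rewards: "i \<in> {1..K} \<Longrightarrow> (\<integral>s. fst (snd s) i \<partial>law T) = \<mu> i * pulls i"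
proof -
  assume i: "i \<in> {1..K}"
  have nonneg: "AE s in law T. 0 \<le> fst (snd s) i"
    using AE_reachable by (rule eventually_mono) (use i in \<open>simp add: reachable_def\<close>)
  have "ennreal (\<integral>s. fst (snd s) i \<partial>law T) = (\<integral>\<^sup>+s. ennreal (fst (snd s) i) \<partial>law T)"
    by (intro nn_integral_eq_integral[symmetric] integrable_rewards i nonneg)
  also have "\<dots> = ennreal (\<mu> i * pulls i)"
    using arm_mean_bounds[OF i] pulls_nonneg
    by (simp add: nn_integral_rewards_eq[OF i] nn_integral_pulls[OF i] ennreal_mult)
  finally show ?thesis
    using arm_mean_bounds[OF i] pulls_nonneg[of i] integral_nonneg_AE[OF nonneg]
    by (simp add: ennreal_inj)
qed

text \<open>Wald's identity gives the collected reward, and \<open>T * \<mu> 1\<close> is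
  distributed over the arms because the expected counts add up to \<open>T\<close>.\<close>

lemma regret_eq: "ts_ma_regret K p \<nu> tie T \<alpha> = (\<Sum>i\<in>{1..K}. gap p i * pulls i)"
proof -
  have "(\<integral>(n, S, \<theta>). (\<Sum>i\<in>{1..K}. S i) \<partial>law T) = (\<integral>s. (\<Sum>i\<in>{1..K}. fst (snd s) i) \<partial>law T)"
    by (simp add: case_prod_unfold)
  also have "\<dots> = (\<Sum>i\<in>{1..K}. \<integral>s. fst (snd s) i \<partial>law T)"
    by (intro Bochner_Integration.integral_sum integrable_rewards)
  also have "\<dots> = (\<Sum>i\<in>{1..K}. \<mu> i * pulls i)"
    by (intro sum.cong refl integral_rewards)
  finally show ?thesis
    using sum_pulls by (simp add: ts_ma_regret_def gap_def left_diff_distrib sum_subtractf flip: sum_distrib_left)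
qed

lemma pulls_le:
  assumes i: "i \<in> {1..K}" "i \<noteq> 1"
  shows "pulls i \<le> (38 + 2 / c0) * (L powr (\<alpha> + 1) / (gap p i)\<^sup>2)"
proof -
  define X where "X = L powr (\<alpha> + 1) / (gap p i)\<^sup>2"
  have c0: "c0 > 0" by (simp add: c0_def)
  have g: "0 < (gap p i)\<^sup>2" "(gap p i)\<^sup>2 \<le> 1"
    using gap_pos[OF i] gap_le_one[OF i(1)] by (auto simp: power_le_one)
  have LX: "L powr (\<alpha> + 1) \<le> X"
  proof -
    have "L powr (\<alpha> + 1) * (gap p i)\<^sup>2 \<le> L powr (\<alpha> + 1) * 1"
      by (intro mult_left_mono g) simp
    thus ?thesis using g by (simp add: X_def le_divide_eq)
  qed
  show ?thesis
  proof (cases "L \<ge> 1")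
    case True
    have "1 \<le> L powr (\<alpha> + 1)" using True \<alpha> by (intro ge_one_powr_ge_zero) auto
    hence X1: "X \<ge> 1" using LX by simp
    define U where "U = nat \<lceil>32 * X\<rceil>"
    have U: "32 * X \<le> real U" "real U \<le> 32 * X + 1"
      unfolding U_def using X1 of_int_ceiling_le_add_one[of "32 * X"] by (auto simp: of_nat_ceiling)
    hence U1: "U \<ge> 1" using X1 by simp
    have "ennreal (pulls i) \<le> ennreal (real U + 1 + real T * ((4 + 2 / c0) / real T))"
      unfolding nn_integral_pulls[OF i(1), symmetric]
    proof (rule nn_integral_pulls_le[OF i(1) U1])
      fix t assume "t \<le> T"
      thus "emeasure (law t) (bad U i) \<le> ennreal ((4 + 2 / c0) / real T)"
        using U(1) by (intro emeasure_bad_le True i U1) (simp_all add: X_def)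
    qed (use c0 in simp)
    also have "real T * ((4 + 2 / c0) / real T) = 4 + 2 / c0"
      using T by simp
    finally have "pulls i \<le> real U + 1 + (4 + 2 / c0)"
      using c0 by (subst (asm) ennreal_le_iff) (auto simp: add_nonneg_nonneg)
    \<comment> \<open>The 6 consists of 1 for rounding up \<open>U\<close>, 1 for the initialization
      pull and 4 from the bad states.\<close>
    also have "\<dots> \<le> 32 * X + (6 + 2 / c0) * 1" using U(2) by simp
    also have "\<dots> \<le> 32 * X + (6 + 2 / c0) * X"
      using X1 c0 by (intro add_left_mono mult_left_mono) auto
    finally show ?thesis unfolding X_def[symmetric] by (simp add: algebra_simps)
  next
    case False
    \<comment> \<open>Only \<open>T = 2\<close> has \<open>L < 1\<close>. There at most 2 pulls
      occur, while \<open>X\<close> is at least \<open>L^2\<close>, hence at least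
      \<open>4 / 9\<close>, and \<open>38 * 4 / 9\<close> exceeds 2.\<close>
    have "T < 3"
    proof (rule ccontr)
      assume "\<not> T < 3"
      hence "exp 1 \<le> real T" using exp_le by linarith
      hence "1 \<le> L" using T by (simp add: ln_ge_iff)
      thus False using False by simp
    qed
    hence T2: "T = 2" using T by simp
    have L: "2 / 3 \<le> L" "L \<le> 1" using False ln2_ge_two_thirds T2 by auto
    have "(2 / 3)\<^sup>2 \<le> L\<^sup>2" using L by (intro power_mono) auto
    also have "L\<^sup>2 = L powr 2" using ln_T_pos by (simp add: powr_numeral)
    also have "\<dots> \<le> L powr (\<alpha> + 1)" using L \<alpha> by (intro powr_mono') auto
    finally have X: "4 / 9 \<le> X" using LX by (simp add: power2_eq_square)
    have "pulls i \<le> 2" using pulls_le_T[OF i(1)] T2 by simp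
    also have "\<dots> \<le> 38 * X" using X by simp
    also have "\<dots> \<le> (38 + 2 / c0) * X" using X c0 by (intro mult_right_mono) auto
    finally show ?thesis by (simp add: X_def)
  qed
qed

lemma problem_dependent_regret:
  "ts_ma_regret K p \<nu> tie T \<alpha>
    \<le> (\<Sum>i | i \<in> {1..K} \<and> gap p i > 0. (38 + 2 / c0) * (L powr (\<alpha> + 1) / gap p i))"
proof -
  have "ts_ma_regret K p \<nu> tie T \<alpha> = (\<Sum>i | i \<in> {1..K} \<and> gap p i > 0. gap p i * pulls i)"
    unfolding regret_eq
  proof (rule sum.mono_neutral_right)
    show "\<forall>i\<in>{1..K} - {i. i \<in> {1..K} \<and> gap p i > 0}. gap p i * pulls i = 0"
    proof
      fix i assume "i \<in> {1..K} - {i. i \<in> {1..K} \<and> gap p i > 0}"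
      hence "i = 1" using gap_pos[of i] by blast
      thus "gap p i * pulls i = 0" by (simp add: gap_def)
    qed
  qed auto
  also have "\<dots> \<le> (\<Sum>i | i \<in> {1..K} \<and> gap p i > 0. (38 + 2 / c0) * (L powr (\<alpha> + 1) / gap p i))"
  proof (rule sum_mono)
    fix i assume "i \<in> {i. i \<in> {1..K} \<and> gap p i > 0}"
    hence i: "i \<in> {1..K}" and g: "gap p i > 0" by auto
    hence "i \<noteq> 1" by (auto simp: gap_def)
    from pulls_le[OF i this]
    have "gap p i * pulls i \<le> gap p i * ((38 + 2 / c0) * (L powr (\<alpha> + 1) / (gap p i)\<^sup>2))"
      using g by (intro mult_left_mono) auto
    also have "\<dots> = (38 + 2 / c0) * (L powr (\<alpha> + 1) / gap p i)"
      using g by (simp add: power2_eq_square)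
    finally show "gap p i * pulls i \<le> (38 + 2 / c0) * (L powr (\<alpha> + 1) / gap p i)" .
  qed
  finally show ?thesis .
qed

text \<open>Arms with gap at most \<open>e\<close> cost at most \<open>e * T\<close> together,
  because the counts add up to \<open>T\<close>. Each arm with a larger gap costs at most
  \<open>C * (Y / e)\<close> by \<open>pulls_le\<close>.\<close>

lemma worst_case_regret:
  "ts_ma_regret K p \<nu> tie T \<alpha> \<le> (39 + 2 / c0) * sqrt (real K * real T * L powr (\<alpha> + 1))"
proof -
  define Y where "Y = L powr (\<alpha> + 1)"
  \<comment> \<open>This threshold balances the two contributions:
    \<open>e * T = K * (Y / e)\<close>.\<close>
  define e where "e = sqrt (real K * Y / real T)"
  define C where "C = 38 + 2 / c0"
  have C: "C > 0" by (simp add: C_def c0_def add_pos_nonneg)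
  have Y: "Y > 0" using ln_T_pos by (simp add: Y_def)
  have KT: "real K > 0" "real T > 0" using two_arms T by auto
  have e: "e > 0" using Y KT by (simp add: e_def)
  have eT: "e * real T = sqrt (real K * real T * Y)"
  proof -
    have "real K * real T * Y = (real K * Y / real T) * (real T)\<^sup>2"
      using KT by (simp add: power2_eq_square)
    hence "sqrt (real K * real T * Y) = sqrt (real K * Y / real T) * sqrt ((real T)\<^sup>2)"
      by (simp only: real_sqrt_mult)
    thus ?thesis by (simp add: e_def)
  qed
  have "e\<^sup>2 * real T = real K * Y"
    using Y KT by (simp add: e_def)
  hence eK: "real K * (Y / e) = e * real T"
    using e by (simp add: field_simps power2_eq_square)
  have "gap p i * pulls i \<le> e * pulls i + C * (Y / e)" if i: "i \<in> {1..K}" for i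
  proof (cases "gap p i \<le> e")
    case True
    hence "gap p i * pulls i \<le> e * pulls i" by (intro mult_right_mono pulls_nonneg)
    moreover have "0 \<le> C * (Y / e)" using C Y e by simp
    ultimately show ?thesis by linarith
  next
    case False
    hence g: "gap p i > e" by simp
    hence "i \<noteq> 1" using e by (auto simp: gap_def)
    from pulls_le[OF i this]
    have "gap p i * pulls i \<le> gap p i * (C * (Y / (gap p i)\<^sup>2))"
      using g e by (intro mult_left_mono) (auto simp: C_def Y_def)
    also have "\<dots> = C * (Y / gap p i)"
      using g e by (simp add: power2_eq_square)
    also have "\<dots> \<le> C * (Y / e)"
      using g e C Y by (intro mult_left_mono divide_left_mono) auto
    finally show ?thesis using e pulls_nonneg[of i] by (simp add: add_increasing)
  qed
  hence "ts_ma_regret K p \<nu> tie T \<alpha> \<le> (\<Sum>i\<in>{1..K}. e * pulls i + C * (Y / e))"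
    unfolding regret_eq by (rule sum_mono)
  also have "\<dots> = e * real T + C * (real K * (Y / e))"
    using sum_pulls by (simp add: sum.distrib mult.left_commute flip: sum_distrib_left)
  also have "\<dots> = (39 + 2 / c0) * sqrt (real K * real T * Y)"
    unfolding eK eT by (simp add: C_def algebra_simps)
  finally show ?thesis by (simp add: Y_def)
qed

end

text \<open>Choosing \<open>C\<close> before all other quantities expresses that the constant hidden
  in the O-notation is universal, and the same \<open>C\<close> serves both bounds.\<close>

theorem theorem3:
  shows "\<exists>C>0. \<forall>K p \<nu> tie. \<forall>T::nat. \<forall>\<alpha>::real.
    stochastic_bandit K p \<nu> \<and> tie_breaking K tie \<and> T \<ge> 2 \<and> 0 \<le> \<alpha> \<and> \<alpha> \<le> 1 \<longrightarrow>
      ts_ma_regret K p \<nu> tie T \<alpha>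
        \<le> (\<Sum>i | i \<in> {1..K} \<and> gap p i > 0. C * (ln (real T) powr (\<alpha> + 1) / gap p i)) \<and>
      ts_ma_regret K p \<nu> tie T \<alpha>
        \<le> C * sqrt (real K * real T * ln (real T) powr (\<alpha> + 1))"
\<comment> \<open>The worst-case constant is the larger one: 1 for the arms with small gap is added
  to the constant \<open>38 + 2 / c0\<close> of \<open>pulls_le\<close>.\<close>
proof (intro exI[of _ "39 + 2 / c0"] conjI allI impI; (elim conjE)?)
  have c0: "c0 > 0" by (simp add: c0_def)
  thus "39 + 2 / c0 > 0" by (simp add: add_pos_nonneg)
  fix K p \<nu> tie and T :: nat and \<alpha> :: real
  assume *: "stochastic_bandit K p \<nu>" "tie_breaking K tie" "T \<ge> 2" "0 \<le> \<alpha>" "\<alpha> \<le> 1"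
  interpret ts_ma K p \<nu> tie T \<alpha>
    using * by (simp add: ts_ma_def ts_ma_axioms_def)
  show "ts_ma_regret K p \<nu> tie T \<alpha> \<le> (39 + 2 / c0) * sqrt (real K * real T * ln (real T) powr (\<alpha> + 1))"
    by (rule worst_case_regret)
  have "(\<Sum>i | i \<in> {1..K} \<and> gap p i > 0. (38 + 2 / c0) * (ln (real T) powr (\<alpha> + 1) / gap p i))
    \<le> (\<Sum>i | i \<in> {1..K} \<and> gap p i > 0. (39 + 2 / c0) * (ln (real T) powr (\<alpha> + 1) / gap p i))"
    by (intro sum_mono mult_right_mono) auto
  with problem_dependent_regret
  show "ts_ma_regret K p \<nu> tie T \<alpha>
      \<le> (\<Sum>i | i \<in> {1..K} \<and> gap p i > 0. (39 + 2 / c0) * (ln (real T) powr (\<alpha> + 1) / gap p i))"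
    by linarith
qed

end
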